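(* Let $\mathfrak g$ be a finite-dimensional Lie algebra over a field of characteristic zero and let $\mathcal V$ be a torsion-free grading of $\mathfrak g$. Let $\widetilde{\mathcal V}$ be the universal realization of $\mathcal V$, with grading group identified with some $\mathbb Z^k$, and let $\alpha_1,\dots,\alpha_N\in\mathbb Z^k$ ($N\ge1$) be its distinct weights. Put $$M=1+\max\Big(\max_{i,j}\|\alpha_i-\alpha_j\|_\infty,\ \max_i\|\alpha_i\|_\infty\Big),\qquad C=(3+N2^{N+1})M^k,$$ and consider the integer linear programming problem in the variables $z\in\mathbb Z$, $w\in\mathbb Z^k$ and $b_{ij}\in\{0,1\}$ ($1\le i<j\le N$): $$\begin{aligned}\text{minimize } & z\\ \text{subject to } & z\ge\langle w,\alpha_i\rangle\ge1, && 1\le i\le N,\\ & \langle w,\alpha_i-\alpha_j\rangle\ge b_{ij}-C(1-b_{ij}), && 1\le i<j\le N,\\ & \langle w,\alpha_i-\alpha_j\rangle\le b_{ij}-1+Cb_{ij}, && 1\le i<j\le N,\end{aligned}$$ where $\langle\cdot,\cdot\rangle$ is the standard inner product. Then: (a) If this problem has no solution, then $\mathcal V$ has no positive realization. (b) If $(z,w,(b_{ij}))$ is an optimal solution and $f:\mathbb Z^k\to\mathbb Z$ is the homomorphism $f(\cdot)=\langle w,\cdot\rangle$, then the push-forward grading $f_*\widetilde{\mathcal V}$ is a positive realization of $\mathcal V$ with integer weights, and its largest weight is the smallest possible among all positive realizations of $\mathcal V$ with integer weights.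
   Context: A grading of a Lie algebra $\mathfrak g$ over an abelian group $A$ (an $A$-grading) is a direct sum decomposition $\mathcal V:\mathfrak g=\bigoplus_{\alpha\in A}V_\alpha$ into subspaces (layers) with $[V_\alpha,V_\beta]\subset V_{\alpha+\beta}$ for all $\alpha,\beta\in A$; its weights are the $\alpha$ with $V_\alpha\ne0$. The grading is torsion-free if $A$ is torsion-free. An $\mathbb R$-grading is positive if all its weights are $>0$. For a homomorphism $f:A\to B$ of abelian groups, the push-forward $f_*\mathcal V$ is the $B$-grading with layers $\bigoplus_{\alpha\in f^{-1}(\beta)}V_\alpha$, $\beta\in B$. A realization of an $A$-grading $\mathcal V$ with set of weights $\Omega$ is a grading $\mathcal W$ over an abelian group $B$ such that, for some injective map $f:\Omega\to B$, $W_{f(\alpha)}=V_\alpha$ for all $\alpha\in\Omega$ (and all other layers are zero). A positive realization is a realization as a positive $\mathbb R$-grading. A universal realization of $\mathcal V$ is a realization $\widetilde{\mathcal V}$ over some abelian group $A$ such that for every realization of $\mathcal V$ as a $B$-grading there is a unique homomorphism $f:A\to B$ such that this $B$-grading equals $f_*\widetilde{\mathcal V}$. *)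

theory Defs
  imports Complex_Main "HOL-Algebra.Product_Groups"
begin

section \<open>Grading groups\<close>

text \<open>Abelian groups are the multiplicatively written commutative groups of HOL-Algebra, so that
  one can quantify over them inside a formula.\<close>

definition torsion_free_group :: "('a, 'c) monoid_scheme \<Rightarrow> bool" where
  "torsion_free_group A \<longleftrightarrow>
     (\<forall>a\<in>carrier A. \<forall>n::nat. n > 0 \<longrightarrow> a [^]\<^bsub>A\<^esub> n = \<one>\<^bsub>A\<^esub> \<longrightarrow> a = \<one>\<^bsub>A\<^esub>)"

definition real_group :: "real monoid" where
  "real_group = \<lparr>carrier = UNIV, monoid.mult = (+), one = 0\<rparr>"

text \<open>The coordinates of \<open>\<int>\<^sup>k\<close> are indexed by \<open>{..<k}\<close>; \<open>k = 0\<close> is allowed and does occur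
  (for instance for the trivial grading of a perfect Lie algebra).\<close>

definition int_pow_group :: "nat \<Rightarrow> (nat \<Rightarrow> int) monoid" where
  "int_pow_group k = product_group {..<k} (\<lambda>_. integer_group)"

definition int_inner :: "nat \<Rightarrow> (nat \<Rightarrow> int) \<Rightarrow> (nat \<Rightarrow> int) \<Rightarrow> int" where
  "int_inner k x y = (\<Sum>m<k. x m * y m)"

text \<open>The inserted 0 only matters for \<open>k = 0\<close>.\<close>

definition int_sup_norm :: "nat \<Rightarrow> (nat \<Rightarrow> int) \<Rightarrow> int" where
  "int_sup_norm k x = Max (insert 0 ((\<lambda>m. \<bar>x m\<bar>) ` {..<k}))"


section \<open>Lie algebras and gradings\<close>

locale lie_algebra = vector_space scale
  for scale :: "'k::field \<Rightarrow> 'g::ab_group_add \<Rightarrow> 'g" +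
  fixes bracket :: "'g \<Rightarrow> 'g \<Rightarrow> 'g"
  assumes linear_bracket_left: "Vector_Spaces.linear scale scale (\<lambda>x. bracket x y)"
    and linear_bracket_right: "Vector_Spaces.linear scale scale (\<lambda>y. bracket x y)"
    and bracket_self: "bracket x x = 0"
    and jacobi: "bracket x (bracket y z) + bracket y (bracket z x) + bracket z (bracket x y) = 0"
begin

text \<open>A grading is given by its layers \<open>V a\<close> for \<open>a \<in> carrier A\<close>; values of \<open>V\<close> outside the carrier
  are irrelevant throughout.\<close>

definition direct_sum_decomposition :: "'a set \<Rightarrow> ('a \<Rightarrow> 'g set) \<Rightarrow> bool" where
  "direct_sum_decomposition I V \<longleftrightarrow>
     (\<forall>a\<in>I. subspace (V a)) \<and>
     (\<forall>x. \<exists>!c. (\<forall>a\<in>I. c a \<in> V a) \<and> (\<forall>a. a \<notin> I \<longrightarrow> c a = 0) \<and>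
               finite {a. c a \<noteq> 0} \<and> x = (\<Sum>a | c a \<noteq> 0. c a))"

definition grading :: "'a monoid \<Rightarrow> ('a \<Rightarrow> 'g set) \<Rightarrow> bool" where
  "grading A V \<longleftrightarrow>
     comm_group A \<and> direct_sum_decomposition (carrier A) V \<and>
     (\<forall>a\<in>carrier A. \<forall>b\<in>carrier A. \<forall>x\<in>V a. \<forall>y\<in>V b. bracket x y \<in> V (a \<otimes>\<^bsub>A\<^esub> b))"

definition weights :: "'a monoid \<Rightarrow> ('a \<Rightarrow> 'g set) \<Rightarrow> 'a set" where
  "weights A V = {a \<in> carrier A. V a \<noteq> {0}}"

text \<open>The direct sum of layers is formed inside the Lie algebra, i.e. as the span of their union.\<close>

definition pushforward :: "'a monoid \<Rightarrow> ('a \<Rightarrow> 'b) \<Rightarrow> ('a \<Rightarrow> 'g set) \<Rightarrow> 'b \<Rightarrow> 'g set" where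
  "pushforward A f V = (\<lambda>b. span (\<Union>a\<in>{a \<in> carrier A. f a = b}. V a))"

text \<open>\<open>realization A V B W\<close>: the \<open>B\<close>-grading \<open>W\<close> is a realization of the \<open>A\<close>-grading \<open>V\<close>.\<close>

definition realization ::
  "'a monoid \<Rightarrow> ('a \<Rightarrow> 'g set) \<Rightarrow> 'b monoid \<Rightarrow> ('b \<Rightarrow> 'g set) \<Rightarrow> bool" where
  "realization A V B W \<longleftrightarrow>
     grading B W \<and>
     (\<exists>f. inj_on f (weights A V) \<and> f ` weights A V \<subseteq> carrier B \<and>
          (\<forall>a\<in>weights A V. W (f a) = V a) \<and>
          (\<forall>b\<in>carrier B - f ` weights A V. W b = {0}))"

definition positive_realization ::
  "'a monoid \<Rightarrow> ('a \<Rightarrow> 'g set) \<Rightarrow> (real \<Rightarrow> 'g set) \<Rightarrow> bool" where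
  "positive_realization A V W \<longleftrightarrow>
     realization A V real_group W \<and> (\<forall>r\<in>weights real_group W. r > 0)"

text \<open>\<open>universal_realization TYPE('b) A V U W\<close>: the \<open>U\<close>-grading \<open>W\<close> is a universal realization of
  \<open>V\<close>, where the test groups \<open>B\<close> of the universal property are all abelian groups whose elements
  are taken from the type \<open>'b\<close> (HOL cannot quantify over all types in a formula). For a
  finite-dimensional Lie algebra and a countable \<open>U\<close>, such as \<open>\<int>\<^sup>k\<close>, every infinite type \<open>'b\<close> gives
  the same notion: the universal property only involves countable subgroups of the test groups,
  and these have isomorphic copies in \<open>'b\<close>.
  Restricting \<open>f\<close> to extensional functions makes uniqueness mean uniqueness on \<open>carrier U\<close>.\<close>

definition universal_realization ::
  "'b itself \<Rightarrow> 'a monoid \<Rightarrow> ('a \<Rightarrow> 'g set) \<Rightarrow> 'u monoid \<Rightarrow> ('u \<Rightarrow> 'g set) \<Rightarrow> bool" where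
  "universal_realization _ A V U W \<longleftrightarrow>
     realization A V U W \<and>
     (\<forall>(B :: 'b monoid) X. realization A V B X \<longrightarrow>
        (\<exists>!f. f \<in> hom U B \<and> f \<in> extensional (carrier U) \<and>
              (\<forall>b\<in>carrier B. X b = pushforward U f W b)))"

end


section \<open>The integer linear program\<close>

definition ilp_M :: "nat \<Rightarrow> nat \<Rightarrow> (nat \<Rightarrow> nat \<Rightarrow> int) \<Rightarrow> int" where
  "ilp_M k N \<alpha> =
     1 + max (Max {int_sup_norm k (\<lambda>m. \<alpha> i m - \<alpha> j m) | i j. i \<in> {1..N} \<and> j \<in> {1..N}})
             (Max {int_sup_norm k (\<alpha> i) | i. i \<in> {1..N}})"

definition ilp_C :: "nat \<Rightarrow> nat \<Rightarrow> (nat \<Rightarrow> nat \<Rightarrow> int) \<Rightarrow> int" where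
  "ilp_C k N \<alpha> = (3 + int N * 2 ^ (N + 1)) * ilp_M k N \<alpha> ^ k"

text \<open>Only the values \<open>b i j\<close> with \<open>1 \<le> i < j \<le> N\<close> are variables of the problem.\<close>

definition ilp_feasible ::
  "nat \<Rightarrow> nat \<Rightarrow> (nat \<Rightarrow> nat \<Rightarrow> int) \<Rightarrow> int \<Rightarrow> (nat \<Rightarrow> int) \<Rightarrow> (nat \<Rightarrow> nat \<Rightarrow> int) \<Rightarrow> bool" where
  "ilp_feasible k N \<alpha> z w b \<longleftrightarrow>
     w \<in> carrier (int_pow_group k) \<and>
     (\<forall>i\<in>{1..N}. z \<ge> int_inner k w (\<alpha> i) \<and> int_inner k w (\<alpha> i) \<ge> 1) \<and>
     (\<forall>i\<in>{1..N}. \<forall>j\<in>{1..N}. i < j \<longrightarrow>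
        b i j \<in> {0, 1} \<and>
        int_inner k w (\<lambda>m. \<alpha> i m - \<alpha> j m) \<ge> b i j - ilp_C k N \<alpha> * (1 - b i j) \<and>
        int_inner k w (\<lambda>m. \<alpha> i m - \<alpha> j m) \<le> b i j - 1 + ilp_C k N \<alpha> * b i j)"

definition ilp_optimal ::
  "nat \<Rightarrow> nat \<Rightarrow> (nat \<Rightarrow> nat \<Rightarrow> int) \<Rightarrow> int \<Rightarrow> (nat \<Rightarrow> int) \<Rightarrow> (nat \<Rightarrow> nat \<Rightarrow> int) \<Rightarrow> bool" where
  "ilp_optimal k N \<alpha> z w b \<longleftrightarrow>
     ilp_feasible k N \<alpha> z w b \<and>
     (\<forall>z' w' b'. ilp_feasible k N \<alpha> z' w' b' \<longrightarrow> z \<le> z')"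

text \<open>The homomorphism \<open>\<langle>w, \<cdot>\<rangle> : \<int>\<^sup>k \<rightarrow> \<int>\<close>, composed with \<open>\<int> \<subseteq> \<real>\<close> because positive realizations
  are \<open>\<real>\<close>-gradings.\<close>

definition inner_hom :: "nat \<Rightarrow> (nat \<Rightarrow> int) \<Rightarrow> (nat \<Rightarrow> int) \<Rightarrow> real" where
  "inner_hom k w = (\<lambda>x. real_of_int (int_inner k w x))"

end

theory Submission
  imports Defs "Jordan_Normal_Form.Determinant"
begin

text \<open>A realization of \<open>V\<close> over a group \<open>B\<close> is an injective labelling of the weights by elements of
  \<open>B\<close> satisfying the relations \<open>x\<^sub>i + x\<^sub>j = x\<^sub>l\<close> that come from the non-vanishing brackets of layers.
  For \<open>B = \<int>\<close> the universal property turns such a labelling into \<open>x\<^sub>i = \<langle>w, \<alpha>\<^sub>i\<rangle>\<close> for some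
  \<open>w \<in> \<int>\<^sup>k\<close>. It is feasible for the program unless it is too large, so it suffices to find one
  feasible point with \<open>z \<le> C + 1\<close> whenever a positive realization exists.

  Given a positive real solution of the relations, the polyhedron cut out by the relations and
  \<open>x\<^sub>i \<ge> 1\<close> has a vertex. By Cramer's rule its coordinates have a common denominator such that all
  numerators are determinants, whose rows have positive and negative parts of sum at most 2; hence
  these determinants are at most \<open>2\<^sup>N\<close> by Schinzel's inequality. This gives a positive integer
  solution \<open>y\<close>, possibly with repeated values, bounded by \<open>2\<^sup>N\<close>. The labels
  \<open>M\<^sup>k y\<^sub>i + \<langle>(1, M, \<dots>, M\<^sup>k\<^sup>-\<^sup>1), \<alpha>\<^sub>i\<rangle>\<close> are positive and bounded by \<open>C\<close>, and they are distinct by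
  uniqueness of expansions in base \<open>M\<close>.\<close>


section \<open>Small integer solutions of additive systems\<close>

text \<open>The index shift is the one by which \<open>mat_delete\<close> skips column
  \<open>i\<close>.\<close>

lemma sum_skip_index:
  fixes g :: "nat \<Rightarrow> 'a::comm_monoid_add"
  assumes "i \<le> n"
  shows "(\<Sum>m<n. g (if m < i then m else Suc m)) = (\<Sum>m\<in>{..<Suc n} - {i}. g m)"
proof (rule sum.reindex_bij_betw[where h = "\<lambda>m. if m < i then m else Suc m"])
  show "bij_betw (\<lambda>m. if m < i then m else Suc m) {..<n} ({..<Suc n} - {i})"
    by (rule bij_betw_byWitness[where f' = "\<lambda>m. if m < i then m else m - 1"])
      (use assms in \<open>auto split: if_splits\<close>)
qed

text \<open>Meant for a row \<open>r\<close> and the cofactors \<open>c\<close> along it. The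
  positive part of \<open>r\<close> contributes at most \<open>b\<close> times the largest
  \<open>c j\<close>, the negative part at most \<open>-b\<close> times the smallest one, so only
  the spread of the values counts and not their number.\<close>

lemma abs_sum_le_spread:
  fixes r c :: "nat \<Rightarrow> 'a::linordered_idom"
  assumes pos: "(\<Sum>j<n. max (r j) 0) \<le> b" and neg: "(\<Sum>j<n. max (- r j) 0) \<le> b"
    and size: "\<And>j. j < n \<Longrightarrow> \<bar>c j\<bar> \<le> d"
    and diff: "\<And>i j. i < n \<Longrightarrow> j < n \<Longrightarrow> i \<noteq> j \<Longrightarrow> c i - c j \<le> d"
    and d: "0 \<le> d"
  shows "\<bar>\<Sum>j<n. r j * c j\<bar> \<le> b * d"
proof -
  \<comment> \<open>Adjoining 0 gives \<open>l \<le> 0 \<le> u\<close>, so the part sums may be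
    replaced by their bound \<open>b\<close>. It is also why \<open>size\<close> is assumed beside
    \<open>diff\<close>: one end of the spread may be this 0.\<close>
  define S where "S = insert 0 (c ` {..<n})"
  define u l where "u = Max S" and "l = Min S"
  have S: "finite S" "S \<noteq> {}" by (simp_all add: S_def)
  have "u \<in> S" "l \<in> S" using Max_in[OF S] Min_in[OF S] by (simp_all add: u_def l_def)
  then have ul: "u - l \<le> d"
    unfolding S_def using d size diff by (auto simp: abs_le_iff) (metis diff_self)
  have u0: "0 \<le> u" "l \<le> 0" using S by (auto simp: u_def l_def S_def)
  have b: "0 \<le> b" using pos sum_nonneg[of "{..<n}" "\<lambda>j. max (r j) 0"] by force
  have cu: "c j \<le> u" "l \<le> c j" if "j < n" for j
    using S that by (auto simp: u_def l_def S_def)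
  have eq: "r j * c j = max (r j) 0 * c j - max (- r j) 0 * c j" for j
    by (auto simp: max_def)
  have "(\<Sum>j<n. r j * c j) \<le> (\<Sum>j<n. max (r j) 0 * u - max (- r j) 0 * l)"
    unfolding eq by (intro sum_mono diff_mono mult_left_mono cu) auto
  also have "\<dots> = (\<Sum>j<n. max (r j) 0) * u + (\<Sum>j<n. max (- r j) 0) * (- l)"
    by (simp add: sum_subtractf sum_distrib_right sum_negf)
  also have "\<dots> \<le> b * u + b * (- l)"
    using pos neg u0 by (intro add_mono mult_right_mono) auto
  also have "\<dots> = b * (u - l)" by (simp add: algebra_simps)
  finally have 1: "(\<Sum>j<n. r j * c j) \<le> b * (u - l)" .
  have "(\<Sum>j<n. r j * c j) \<ge> (\<Sum>j<n. max (r j) 0 * l - max (- r j) 0 * u)"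
    unfolding eq by (intro sum_mono diff_mono mult_left_mono cu) auto
  moreover have "(\<Sum>j<n. max (r j) 0 * l - max (- r j) 0 * u)
      = - ((\<Sum>j<n. max (r j) 0) * (- l) + (\<Sum>j<n. max (- r j) 0) * u)"
    by (simp add: sum_subtractf sum_distrib_right sum_negf)
  moreover have "(\<Sum>j<n. max (r j) 0) * (- l) + (\<Sum>j<n. max (- r j) 0) * u \<le> b * (- l) + b * u"
    using pos neg u0 by (intro add_mono mult_right_mono) auto
  ultimately have 2: "- (\<Sum>j<n. r j * c j) \<le> b * (u - l)" by (simp add: algebra_simps)
  have "b * (u - l) \<le> b * d" using ul b by (rule mult_left_mono)
  with 1 2 show ?thesis by (simp add: abs_le_iff)
qed

text \<open>Expand along the first row. By \<open>abs_sum_le_spread\<close> it is enough that the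
  cofactors, and also their pairwise differences, are at most \<open>b ^ n\<close>; each such
  quantity is, up to sign, a minor covered by the induction hypothesis.\<close>

lemma schinzel_det_bound:
  fixes A :: "'a::linordered_idom mat"
  assumes "A \<in> carrier_mat n n"
    and "\<And>i. i < n \<Longrightarrow> (\<Sum>j<n. max (A $$ (i,j)) 0) \<le> b"
    and "\<And>i. i < n \<Longrightarrow> (\<Sum>j<n. max (- A $$ (i,j)) 0) \<le> b"
  shows "\<bar>det A\<bar> \<le> b ^ n"
  using assms
proof (induction n arbitrary: A)
  case 0
  then show ?case by simp
next
  case (Suc n)
  note A = Suc.prems(1)
  have b: "0 \<le> b"
    using Suc.prems(2)[of 0] sum_nonneg[of "{..<Suc n}" "\<lambda>j. max (A $$ (0,j)) 0"] by force
  define c where "c j = cofactor A 0 j" for j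
  \<comment> \<open>Stated for a general \<open>B\<close> because it is applied both to
    \<open>A\<close> and to the matrix \<open>F\<close> obtained from \<open>A\<close> by a column
    addition.\<close>
  have deleted: "\<bar>cofactor B 0 i\<bar> \<le> b ^ n"
    if i: "i < Suc n" and B: "B \<in> carrier_mat (Suc n) (Suc n)"
      and pos: "\<And>r. 0 < r \<Longrightarrow> r < Suc n \<Longrightarrow> (\<Sum>m\<in>{..<Suc n} - {i}. max (B $$ (r,m)) 0) \<le> b"
      and neg: "\<And>r. 0 < r \<Longrightarrow> r < Suc n \<Longrightarrow> (\<Sum>m\<in>{..<Suc n} - {i}. max (- B $$ (r,m)) 0) \<le> b"
    for i B
  proof -
    have D: "mat_delete B 0 i \<in> carrier_mat n n" using B by (intro carrier_matI) auto
    have el: "mat_delete B 0 i $$ (r, j) = B $$ (Suc r, if j < i then j else Suc j)"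
      if "r < n" "j < n" for r j
      using that B by (simp add: mat_delete_def)
    have "\<bar>det (mat_delete B 0 i)\<bar> \<le> b ^ n"
    proof (rule Suc.IH[OF D])
      fix r assume r: "r < n"
      show "(\<Sum>j<n. max (mat_delete B 0 i $$ (r,j)) 0) \<le> b"
        using pos[of "Suc r"] r i
          sum_skip_index[of i n "\<lambda>m. max (B $$ (Suc r, m)) 0"]
        by (simp add: el del: sum.lessThan_Suc)
      show "(\<Sum>j<n. max (- mat_delete B 0 i $$ (r,j)) 0) \<le> b"
        using neg[of "Suc r"] r i
          sum_skip_index[of i n "\<lambda>m. max (- B $$ (Suc r, m)) 0"]
        by (simp add: el del: sum.lessThan_Suc)
    qed
    then show ?thesis by (simp add: cofactor_def abs_mult power_abs)
  qed
  have size: "\<bar>c j\<bar> \<le> b ^ n" if j: "j < Suc n" for j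
    unfolding c_def
  proof (rule deleted[OF j A])
    fix r assume "0 < r" and r: "r < Suc n"
    have "(\<Sum>m\<in>{..<Suc n} - {j}. max (A $$ (r,m)) 0) \<le> (\<Sum>m<Suc n. max (A $$ (r,m)) 0)"
      by (rule sum_mono2) auto
    with Suc.prems(2)[OF r] show "(\<Sum>m\<in>{..<Suc n} - {j}. max (A $$ (r,m)) 0) \<le> b" by linarith
    have "(\<Sum>m\<in>{..<Suc n} - {j}. max (- A $$ (r,m)) 0) \<le> (\<Sum>m<Suc n. max (- A $$ (r,m)) 0)"
      by (rule sum_mono2) auto
    with Suc.prems(3)[OF r] show "(\<Sum>m\<in>{..<Suc n} - {j}. max (- A $$ (r,m)) 0) \<le> b" by linarith
  qed
  text \<open>The difference of two cofactors is the determinant of \<open>A\<close> with first row \<open>e\<^sub>i - e\<^sub>j\<close>; adding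
    column \<open>i\<close> to column \<open>j\<close> turns it into one minor whose rows still satisfy the bounds.\<close>
  have diff: "c i - c j \<le> b ^ n" if i: "i < Suc n" and j: "j < Suc n" and ij: "i \<noteq> j" for i j
  proof -
    define E where "E = mat (Suc n) (Suc n)
      (\<lambda>(r,m). if r = 0 then (if m = i then 1 else if m = j then -1 else 0) else A $$ (r,m))"
    have E: "E \<in> carrier_mat (Suc n) (Suc n)" by (simp add: E_def)
    have "mat_delete E 0 m = mat_delete A 0 m" for m
      using A by (auto simp: mat_delete_def E_def)
    then have cofE: "cofactor E 0 m = c m" for m by (simp add: cofactor_def c_def)
    have sum2: "(\<Sum>m<Suc n. (if m = i then 1 else if m = j then -1 else 0) * c m) = c i - c j"
    proof -
      have "(\<Sum>m<Suc n. (if m = i then 1 else if m = j then -1 else 0) * c m)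
          = (\<Sum>m<Suc n. (if m = i then c m else 0) - (if m = j then c m else 0))"
        using ij by (intro sum.cong) auto
      also have "\<dots> = c i - c j"
        using i j by (simp add: sum_subtractf sum.delta del: sum.lessThan_Suc)
      finally show ?thesis .
    qed
    have "det E = (\<Sum>m<Suc n. E $$ (0,m) * cofactor E 0 m)"
      by (rule laplace_expansion_row[OF E]) simp
    also have "\<dots> = (\<Sum>m<Suc n. (if m = i then 1 else if m = j then -1 else 0) * c m)"
      unfolding cofE by (intro sum.cong) (auto simp: E_def)
    finally have detE: "det E = c i - c j" using sum2 by simp
    define F where "F = addcol 1 j i E"
    have F: "F \<in> carrier_mat (Suc n) (Suc n)" using E by (simp add: F_def mat_addcol_def)
    have detF: "det F = det E" unfolding F_def by (rule det_addcol[OF i ij[symmetric] E])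
    have F_el: "F $$ (r,m) = (if m = j then E $$ (r,i) + E $$ (r,j) else E $$ (r,m))"
      if "r < Suc n" "m < Suc n" for r m
      using that E by (auto simp: F_def)
    have "det F = (\<Sum>m<Suc n. F $$ (0,m) * cofactor F 0 m)"
      by (rule laplace_expansion_row[OF F]) simp
    also have "\<dots> = (\<Sum>m<Suc n. if m = i then cofactor F 0 m else 0)"
      using i j ij by (intro sum.cong refl) (auto simp: F_el, auto simp: E_def)
    also have "\<dots> = cofactor F 0 i" using i by (simp del: sum.lessThan_Suc)
    finally have detF': "det F = cofactor F 0 i" .
    \<comment> \<open>Column \<open>j\<close> of \<open>F\<close> is the sum of columns
      \<open>i\<close> and \<open>j\<close> of \<open>A\<close> below the first row. Positive and
      negative parts are subadditive, so merging the two columns does not increase the row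
      sums.\<close>
    have merge: "(\<Sum>m\<in>{..<Suc n} - {i}. p (F $$ (r,m))) \<le> b"
      if r: "0 < r" "r < Suc n" and p: "\<And>x y. p (x + y) \<le> p x + (p y :: 'a)"
        and bd: "(\<Sum>m<Suc n. p (A $$ (r,m))) \<le> b" for r p
    proof -
      have fin: "finite ({..<Suc n} - {i} - {j})" by simp
      have ins1: "{..<Suc n} - {i} = insert j ({..<Suc n} - {i} - {j})" using j ij by auto
      have ins2: "{..<Suc n} = insert i (insert j ({..<Suc n} - {i} - {j}))" using i j ij by auto
      have "(\<Sum>m\<in>{..<Suc n} - {i}. p (F $$ (r,m)))
          = p (F $$ (r,j)) + (\<Sum>m\<in>{..<Suc n} - {i} - {j}. p (F $$ (r,m)))"
        by (subst ins1, subst sum.insert[OF fin]) auto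
      also have "(\<Sum>m\<in>{..<Suc n} - {i} - {j}. p (F $$ (r,m)))
          = (\<Sum>m\<in>{..<Suc n} - {i} - {j}. p (A $$ (r,m)))"
        using r by (intro sum.cong refl) (auto simp: F_el, auto simp: E_def)
      also have "F $$ (r,j) = A $$ (r,i) + A $$ (r,j)"
        using r i j by (subst F_el) (auto simp: E_def)
      also have "p (A $$ (r,i) + A $$ (r,j)) + (\<Sum>m\<in>{..<Suc n} - {i} - {j}. p (A $$ (r,m)))
          \<le> p (A $$ (r,i)) + (p (A $$ (r,j)) + (\<Sum>m\<in>{..<Suc n} - {i} - {j}. p (A $$ (r,m))))"
        using p[of "A $$ (r,i)" "A $$ (r,j)"] by (simp add: algebra_simps)
      also have "\<dots> = sum (\<lambda>m. p (A $$ (r,m))) (insert i (insert j ({..<Suc n} - {i} - {j})))"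
        using ij by (subst sum.insert, simp, simp, subst sum.insert) simp_all
      also have "\<dots> = (\<Sum>m<Suc n. p (A $$ (r,m)))" unfolding ins2[symmetric] ..
      finally show ?thesis using bd by simp
    qed
    have "\<bar>cofactor F 0 i\<bar> \<le> b ^ n"
    proof (rule deleted[OF i F])
      fix r assume r: "0 < r" "r < Suc n"
      show "(\<Sum>m\<in>{..<Suc n} - {i}. max (F $$ (r,m)) 0) \<le> b"
        by (rule merge[OF r, where p = "\<lambda>x. max x 0"]) (use Suc.prems(2) r in \<open>auto simp: max_def\<close>)
      show "(\<Sum>m\<in>{..<Suc n} - {i}. max (- F $$ (r,m)) 0) \<le> b"
        by (rule merge[OF r, where p = "\<lambda>x. max (- x) 0"]) (use Suc.prems(3) r in \<open>auto simp: max_def\<close>)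
    qed
    then show ?thesis using detE detF detF' by (simp add: abs_le_iff)
  qed
  have "det A = (\<Sum>j<Suc n. A $$ (0,j) * c j)"
    unfolding c_def by (rule laplace_expansion_row[OF A]) simp
  moreover have "\<bar>\<Sum>j<Suc n. A $$ (0,j) * c j\<bar> \<le> b * b ^ n"
    by (rule abs_sum_le_spread) (use Suc.prems(2,3)[of 0] size diff b in auto)
  ultimately show ?case by simp
qed

section \<open>Vertices and Cramer's rule\<close>

text \<open>An exchange argument: start from the identity matrix and replace its rows one by one by
  elements of \<open>T\<close>. The determinant is linear in the replaced row with the cofactors as
  coefficients; were it zero for all of \<open>T\<close>, the cofactors would lie in the common
  kernel and vanish. No division occurs, so this works over the integers.\<close>

lemma nonsingular_row_selection:
  fixes T :: "(nat \<Rightarrow> 'a::comm_ring_1) set"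
  assumes kernel: "\<And>c. (\<And>r. r \<in> T \<Longrightarrow> (\<Sum>j<n. r j * c j) = 0) \<Longrightarrow> \<forall>j<n. c j = 0"
  obtains B where "\<And>i. i < n \<Longrightarrow> B i \<in> T" "det (mat n n (\<lambda>(i,j). B i j)) \<noteq> 0"
proof -
  have "\<exists>B. (\<forall>i<m. B i \<in> T) \<and> det (mat n n (\<lambda>(i,j). B i j)) \<noteq> 0" if "m \<le> n" for m
    using that
  proof (induction m)
    case 0
    have "mat n n (\<lambda>(i,j). if i = j then 1 else 0) = (1\<^sub>m n :: 'a mat)" by auto
    then have "det (mat n n (\<lambda>(i,j). if i = j then 1 else 0 :: 'a)) \<noteq> 0" by simp
    then show ?case by (intro exI[of _ "\<lambda>i j. if i = j then 1 else 0"]) simp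
  next
    case (Suc m)
    then obtain B where B: "\<And>i. i < m \<Longrightarrow> B i \<in> T" "det (mat n n (\<lambda>(i,j). B i j)) \<noteq> 0"
      by auto
    have m: "m < n" using Suc.prems by simp
    define c where "c j = cofactor (mat n n (\<lambda>(i,j). B i j)) m j" for j
    have expand: "det (mat n n (\<lambda>(i,j). (B(m := r)) i j)) = (\<Sum>j<n. r j * c j)" for r
    proof -
      let ?M = "mat n n (\<lambda>(i,j). (B(m := r)) i j)"
      have "mat_delete ?M m j = mat_delete (mat n n (\<lambda>(i,j). B i j)) m j" for j
        by (auto simp: mat_delete_def)
      then have "cofactor ?M m j = c j" for j by (simp add: cofactor_def c_def)
      then show ?thesis
        using laplace_expansion_row[of ?M n m] m by simp
    qed
    \<comment> \<open>Keeping the old row \<open>B m\<close> reproduces the nonzero determinant, so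
      the cofactors do not all vanish.\<close>
    have "(\<Sum>j<n. B m j * c j) \<noteq> 0" using B(2) expand[of "B m"] by (simp add: fun_upd_idem)
    then have "\<not> (\<forall>j<n. c j = 0)" by (metis (no_types, lifting) lessThan_iff mult_zero_right sum.neutral)
    then obtain r where "r \<in> T" "(\<Sum>j<n. r j * c j) \<noteq> 0" using kernel by blast
    then show ?case
      using B(1) expand[of r] by (intro exI[of _ "B(m := r)"]) (auto simp: less_Suc_eq)
  qed
  then show ?thesis using that by blast
qed

text \<open>A vertex of the polyhedron: the constraints that are tight at \<open>x\<close> have no common kernel.\<close>

lemma ex_vertex_of_additive_system:
  fixes x :: "nat \<Rightarrow> real" and R :: "(nat \<times> nat \<times> nat) set"
  assumes "\<And>i. i < n \<Longrightarrow> 1 \<le> x i" and "\<And>i j l. (i,j,l) \<in> R \<Longrightarrow> x i + x j = x l"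
  obtains y where "\<And>i. i < n \<Longrightarrow> 1 \<le> y i" "\<And>i j l. (i,j,l) \<in> R \<Longrightarrow> y i + y j = (y l :: real)"
    "\<And>c. (\<And>i j l. (i,j,l) \<in> R \<Longrightarrow> c i + c j = (c l :: real)) \<Longrightarrow>
       (\<And>i. i < n \<Longrightarrow> y i = 1 \<Longrightarrow> c i = 0) \<Longrightarrow> (\<forall>i<n. c i = 0)"
  using assms
proof (induction "card {i. i < n \<and> x i \<noteq> 1}" arbitrary: x thesis rule: less_induct)
  case less
  show ?case
  proof (cases "\<forall>c. (\<forall>i j l. (i,j,l) \<in> R \<longrightarrow> c i + c j = (c l :: real)) \<longrightarrow>
       (\<forall>i<n. x i = 1 \<longrightarrow> c i = 0) \<longrightarrow> (\<forall>i<n. c i = 0)")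
    case True
    then show ?thesis using less.prems by blast
  next
    case False
    then obtain c0 i0 where c0: "\<And>i j l. (i,j,l) \<in> R \<Longrightarrow> c0 i + c0 j = (c0 l :: real)"
      "\<And>i. i < n \<Longrightarrow> x i = 1 \<Longrightarrow> c0 i = 0" "i0 < n" "c0 i0 \<noteq> 0" by blast
    \<comment> \<open>The sign of the kernel vector is chosen to give it a negative entry, so that
      the ray from \<open>x\<close> in direction \<open>c\<close> leaves the polyhedron.\<close>
    define c where "c i = (if c0 i0 < 0 then c0 i else - c0 i)" for i
    have c: "\<And>i j l. (i,j,l) \<in> R \<Longrightarrow> c i + c j = c l" "\<And>i. i < n \<Longrightarrow> x i = 1 \<Longrightarrow> c i = 0"
      "c i0 < 0"
      using c0 by (auto simp: c_def) (metis add_uminus_conv_diff minus_add_distrib)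
    define S where "S = {i. i < n \<and> c i < 0}"
    \<comment> \<open>The largest step along \<open>c\<close> that keeps every coordinate at least
      1.\<close>
    define t where "t = Min ((\<lambda>i. (x i - 1) / (- c i)) ` S)"
    have S: "finite S" "S \<noteq> {}" using c0(3) c(3) by (auto simp: S_def)
    have "t \<in> (\<lambda>i. (x i - 1) / (- c i)) ` S" unfolding t_def using S by (intro Min_in) auto
    then obtain i1 where i1: "i1 < n" "c i1 < 0" "t = (x i1 - 1) / (- c i1)" by (auto simp: S_def)
    have t0: "0 \<le> t" unfolding i1(3) using i1 less.prems(2)[of i1] by (intro divide_nonneg_pos) auto
    have t1: "t * (- c i) \<le> x i - 1" if "i < n" "c i < 0" for i
    proof -
      have "t \<le> (x i - 1) / (- c i)" unfolding t_def using S that by (intro Min_le) (auto simp: S_def)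
      then show ?thesis using that by (subst (asm) pos_le_divide_eq) auto
    qed
    define x' where "x' i = x i + t * c i" for i
    \<comment> \<open>Tight coordinates stay tight because \<open>c\<close> vanishes there, and the
      minimizing index \<open>i1\<close> becomes tight.\<close>
    have "{i. i < n \<and> x' i \<noteq> 1} \<subset> {i. i < n \<and> x i \<noteq> 1}"
    proof
      show "{i. i < n \<and> x' i \<noteq> 1} \<subseteq> {i. i < n \<and> x i \<noteq> 1}" using c(2) by (auto simp: x'_def)
      have "x' i1 = 1" "x i1 \<noteq> 1" using i1 c(2)[of i1] by (auto simp: x'_def)
      then show "{i. i < n \<and> x' i \<noteq> 1} \<noteq> {i. i < n \<and> x i \<noteq> 1}" using i1(1) by blast
    qed
    then have smaller: "card {i. i < n \<and> x' i \<noteq> 1} < card {i. i < n \<and> x i \<noteq> 1}"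
      by (intro psubset_card_mono) auto
    have ge: "1 \<le> x' i" if "i < n" for i
    proof (cases "c i < 0")
      case True
      then show ?thesis using t1[OF that] by (simp add: x'_def)
    next
      case False
      then show ?thesis using t0 less.prems(2)[OF that] by (simp add: x'_def add_increasing2)
    qed
    have rel: "x' i + x' j = x' l" if "(i,j,l) \<in> R" for i j l
    proof -
      have "x' i + x' j = (x i + x j) + t * (c i + c j)" by (simp add: x'_def algebra_simps)
      then show ?thesis using less.prems(3)[OF that] c(1)[OF that] by (simp add: x'_def)
    qed
    show ?thesis
      by (rule less.hyps[OF smaller]) (use less.prems(1) ge rel in blast)+
  qed
qed

text \<open>By Cramer's rule, clearing the denominators of a vertex makes its coordinates determinants to
  which Schinzel's inequality applies.\<close>

lemma additive_system_small_integer_solution: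
  fixes x :: "nat \<Rightarrow> real" and R :: "(nat \<times> nat \<times> nat) set"
  assumes R: "R \<subseteq> {..<n} \<times> {..<n} \<times> {..<n}"
    and pos: "\<And>i. i < n \<Longrightarrow> 0 < x i" and rel: "\<And>i j l. (i,j,l) \<in> R \<Longrightarrow> x i + x j = x l"
  obtains y :: "nat \<Rightarrow> int" where "\<And>i. i < n \<Longrightarrow> 1 \<le> y i \<and> y i \<le> 2 ^ n"
    "\<And>i j l. (i,j,l) \<in> R \<Longrightarrow> y i + y j = y l"
proof -
  \<comment> \<open>The relations are homogeneous, so dividing by a positive lower bound of the
    \<open>x i\<close> makes all values at least 1. The inserted 1 covers
    \<open>n = 0\<close>.\<close>
  define \<mu> where "\<mu> = Min (insert 1 (x ` {..<n}))"
  have \<mu>: "0 < \<mu>" "\<And>i. i < n \<Longrightarrow> \<mu> \<le> x i" using pos by (auto simp: \<mu>_def)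
  have scaled: "1 \<le> x i / \<mu>" if "i < n" for i using \<mu> that by simp
  have scaled_rel: "x i / \<mu> + x j / \<mu> = x l / \<mu>" if "(i,j,l) \<in> R" for i j l
    using rel[OF that] by (simp add: add_divide_distrib[symmetric])
  obtain v where v: "\<And>i. i < n \<Longrightarrow> 1 \<le> v i" "\<And>i j l. (i,j,l) \<in> R \<Longrightarrow> v i + v j = (v l :: real)"
    and vertex: "\<And>c. (\<And>i j l. (i,j,l) \<in> R \<Longrightarrow> c i + c j = (c l :: real)) \<Longrightarrow>
       (\<And>i. i < n \<Longrightarrow> v i = 1 \<Longrightarrow> c i = 0) \<Longrightarrow> (\<forall>i<n. c i = 0)"
    using ex_vertex_of_additive_system[of n "\<lambda>i. x i / \<mu>" R] scaled scaled_rel by blast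
  define e :: "nat \<Rightarrow> nat \<Rightarrow> int" where "e i m = (if m = i then 1 else 0)" for i m
  \<comment> \<open>\<open>T1\<close> holds the coefficient rows of the relations, \<open>T2\<close>
    those of the constraints tight at \<open>v\<close>. They are integer rows, so the determinants
    below are integers.\<close>
  define T1 where "T1 = {\<lambda>m. e i m + e j m - e l m | i j l. (i,j,l) \<in> R}"
  define T2 where "T2 = {e i | i. i < n \<and> v i = 1}"
  have sum_e: "(\<Sum>m<n. real_of_int (e i m) * c m) = c i" if "i < n" for i and c :: "nat \<Rightarrow> real"
    using that by (simp add: e_def if_distrib[of "\<lambda>t. real_of_int t * _"] cong: if_cong)
  have sum_T1: "(\<Sum>m<n. real_of_int (e i m + e j m - e l m) * c m) = c i + c j - c l"
    if "i < n" "j < n" "l < n" for i j l and c :: "nat \<Rightarrow> real"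
    using that by (simp add: sum_e ring_distribs sum.distrib sum_subtractf)
  have "\<forall>j<n. c j = 0" if ker: "\<And>r. r \<in> T1 \<union> T2 \<Longrightarrow> (\<Sum>m<n. r m * c m) = 0" for c
  proof -
    have ker': "(\<Sum>m<n. real_of_int (r m) * real_of_int (c m)) = 0" if "r \<in> T1 \<union> T2" for r
      using arg_cong[OF ker[OF that], of real_of_int] by simp
    have "\<forall>j<n. real_of_int (c j) = 0"
    proof (rule vertex)
      fix i j l assume ijl: "(i,j,l) \<in> R"
      then have "(\<lambda>m. e i m + e j m - e l m) \<in> T1" by (auto simp: T1_def)
      then show "real_of_int (c i) + real_of_int (c j) = real_of_int (c l)"
        using ker' sum_T1[of i j l "\<lambda>m. real_of_int (c m)"] ijl R by fastforce
    next
      fix i assume i: "i < n" "v i = 1"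
      then have "e i \<in> T2" by (auto simp: T2_def)
      then show "real_of_int (c i) = 0"
        using ker'[of "e i"] sum_e[OF i(1), of "\<lambda>m. real_of_int (c m)"] by simp
    qed
    then show ?thesis by simp
  qed
  then obtain B where B: "\<And>i. i < n \<Longrightarrow> B i \<in> T1 \<union> T2" "det (mat n n (\<lambda>(i,j). B i j)) \<noteq> 0"
    using nonsingular_row_selection[of "T1 \<union> T2" n] by blast
  define A where "A = mat n n (\<lambda>(i,j). B i j)"
  \<comment> \<open>The right-hand side of the linear system with matrix \<open>A\<close> that
    \<open>v\<close> solves: 0 in a relation row, 1 in a tight row.\<close>
  define b :: "nat \<Rightarrow> int" where "b i = (if B i \<in> T1 then 0 else 1)" for i
  define D where "D = det A"
  define C where "C k = replace_col A (vec n b) k" for k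
  have A: "A \<in> carrier_mat n n" by (simp add: A_def)
  have D: "D \<noteq> 0" using B(2) by (simp add: D_def A_def)
  have Bv: "(\<Sum>m<n. real_of_int (B i m) * v m) = real_of_int (b i)" if i: "i < n" for i
  proof (cases "B i \<in> T1")
    case True
    then obtain p q l where "B i = (\<lambda>m. e p m + e q m - e l m)" "(p,q,l) \<in> R"
      by (auto simp: T1_def)
    then show ?thesis using R sum_T1[of p q l v] v(2)[of p q l] True by (auto simp: b_def)
  next
    case False
    then obtain p where "B i = e p" "p < n" "v p = 1" using B(1)[OF i] by (auto simp: T2_def)
    then show ?thesis using False sum_e[of p v] by (simp add: b_def)
  qed
  have cramer: "real_of_int (det (C k)) = v k * real_of_int D" if "k < n" for k
  proof -
    let ?A = "map_mat real_of_int A"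
    have "?A *\<^sub>v vec n v = vec n (\<lambda>i. real_of_int (b i))"
      using Bv by (intro eq_vecI) (auto simp: A_def scalar_prod_def atLeast0LessThan)
    moreover have "replace_col ?A (vec n (\<lambda>i. real_of_int (b i))) k = map_mat real_of_int (C k)"
      by (auto simp: C_def replace_col_def A_def)
    ultimately show ?thesis
      using cramer_lemma_mat[of ?A n "vec n v" k] A that by (simp add: D_def)
  qed
  have bound: "\<bar>det (C k)\<bar> \<le> 2 ^ n" if k: "k < n" for k
  proof (rule schinzel_det_bound)
    show "C k \<in> carrier_mat n n" using A by (simp add: C_def replace_col_def)
    fix i assume i: "i < n"
    have C_el: "C k $$ (i,j) = (if j = k then b i else B i j)" if "j < n" for j
      using that i k by (simp add: C_def replace_col_def A_def)
    have sum_e1: "(\<Sum>j<n. e p j) \<le> 1" for p by (simp add: e_def)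
    \<comment> \<open>Column \<open>k\<close> now contains \<open>b\<close>. In a relation row the
      entry becomes 0, which enlarges neither part. A tight row \<open>e p\<close> may gain a 1 in
      column \<open>k\<close>; its negative part is zero, so \<open>r = k\<close> is a mere
      filler.\<close>
    have "\<exists>p q r. \<forall>j<n. max (C k $$ (i,j)) 0 \<le> e p j + e q j \<and> max (- C k $$ (i,j)) 0 \<le> e r j"
    proof (cases "B i \<in> T1")
      case True
      then obtain p q l where pql: "B i = (\<lambda>m. e p m + e q m - e l m)" by (auto simp: T1_def)
      show ?thesis
        by (rule exI[of _ p], rule exI[of _ q], rule exI[of _ l])
          (use True in \<open>auto simp: C_el b_def pql e_def\<close>)
    next
      case False
      then obtain p where p: "B i = e p" using B(1)[OF i] by (auto simp: T2_def)
      show ?thesis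
        by (rule exI[of _ p], rule exI[of _ k], rule exI[of _ k])
          (use False in \<open>auto simp: C_el b_def p e_def\<close>)
    qed
    then obtain p q r where pqr: "\<And>j. j < n \<Longrightarrow> max (C k $$ (i,j)) 0 \<le> e p j + e q j"
      "\<And>j. j < n \<Longrightarrow> max (- C k $$ (i,j)) 0 \<le> e r j" by blast
    have "(\<Sum>j<n. max (C k $$ (i,j)) 0) \<le> (\<Sum>j<n. e p j + e q j)"
      using pqr(1) by (intro sum_mono) auto
    then show "(\<Sum>j<n. max (C k $$ (i,j)) 0) \<le> 2"
      using sum_e1[of p] sum_e1[of q] by (simp add: sum.distrib)
    have "(\<Sum>j<n. max (- C k $$ (i,j)) 0) \<le> (\<Sum>j<n. e r j)"
      using pqr(2) by (intro sum_mono) auto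
    then show "(\<Sum>j<n. max (- C k $$ (i,j)) 0) \<le> 2"
      using sum_e1[of r] by simp
  qed
  \<comment> \<open>Since \<open>det (C k) = v k * D\<close>, the sign makes \<open>y\<close> the
    multiple of \<open>v\<close> by the positive integer |D|; hence \<open>y\<close> inherits the
    relations and the lower bound 1.\<close>
  define y where "y k = sgn D * det (C k)" for k
  have y: "real_of_int (y k) = v k * real_of_int \<bar>D\<bar>" if "k < n" for k
    using cramer[OF that] by (simp add: y_def abs_sgn algebra_simps)
  show ?thesis
  proof
    fix i assume i: "i < n"
    have "1 * 1 \<le> v i * real_of_int \<bar>D\<bar>" using v(1)[OF i] D by (intro mult_mono) auto
    then have "1 \<le> y i" using y[OF i] by linarith
    moreover have "y i \<le> \<bar>det (C i)\<bar>" using D by (auto simp: y_def sgn_if)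
    ultimately show "1 \<le> y i \<and> y i \<le> 2 ^ n" using bound[OF i] by simp
  next
    fix i j l assume ijl: "(i,j,l) \<in> R"
    then have "i < n" "j < n" "l < n" using R by auto
    then have "real_of_int (y i) + real_of_int (y j) = real_of_int (y l)"
      using y v(2)[OF ijl] by (simp only: distrib_right[symmetric])
    then show "y i + y j = y l" by linarith
  qed
qed


section \<open>Relabelling gradings\<close>

context lie_algebra
begin

section \<open>Layers and push-forwards of gradings\<close>

lemma direct_sum_subspace: "direct_sum_decomposition I V \<Longrightarrow> a \<in> I \<Longrightarrow> subspace (V a)"
  by (simp add: direct_sum_decomposition_def)

text \<open>Otherwise \<open>x\<close> would have two decompositions, one concentrated at
  \<open>a\<close> and one at \<open>b\<close>.\<close>

lemma direct_sum_unique: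
  assumes "direct_sum_decomposition I V" "a \<in> I" "b \<in> I" "x \<in> V a" "x \<in> V b" "x \<noteq> 0"
  shows "a = b"
proof (rule ccontr)
  assume "a \<noteq> b"
  define P where "P c \<longleftrightarrow> (\<forall>a\<in>I. c a \<in> V a) \<and> (\<forall>a. a \<notin> I \<longrightarrow> c a = 0) \<and>
    finite {a. c a \<noteq> 0} \<and> x = (\<Sum>a | c a \<noteq> 0. c a)" for c
  have sub: "0 \<in> V d" if "d \<in> I" for d
    by (rule subspace_0[OF direct_sum_subspace[OF assms(1) that]])
  have P: "P (\<lambda>d. if d = e then x else 0)" if "e \<in> I" "x \<in> V e" for e
  proof -
    have "{d. (if d = e then x else 0) \<noteq> 0} = {e}" using assms(6) by auto
    then show ?thesis unfolding P_def using that sub by simp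
  qed
  have "\<exists>!c. P c" using assms(1) by (simp add: direct_sum_decomposition_def P_def)
  then have "(\<lambda>d. if d = a then x else 0) = (\<lambda>d. if d = b then x else 0)"
    using the1_equality[of P, OF _ P[OF assms(2,4)]] the1_equality[of P, OF _ P[OF assms(3,5)]] by simp
  then have "(if a = a then x else 0) = (if a = b then x else 0)" by (rule fun_cong)
  then show False using \<open>a \<noteq> b\<close> assms(6) by simp
qed

lemma grading_direct_sum: "grading A V \<Longrightarrow> direct_sum_decomposition (carrier A) V"
  unfolding grading_def by (elim conjE)

lemma grading_subspace: "grading A V \<Longrightarrow> a \<in> carrier A \<Longrightarrow> subspace (V a)"
  by (rule direct_sum_subspace[OF grading_direct_sum])

lemma grading_zero_mem: "grading A V \<Longrightarrow> a \<in> carrier A \<Longrightarrow> 0 \<in> V a"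
  by (rule subspace_0[OF grading_subspace])

lemma grading_unique:
  "grading A V \<Longrightarrow> a \<in> carrier A \<Longrightarrow> b \<in> carrier A \<Longrightarrow> x \<in> V a \<Longrightarrow> x \<in> V b \<Longrightarrow> x \<noteq> 0 \<Longrightarrow> a = b"
  by (rule direct_sum_unique[OF grading_direct_sum])

lemma grading_bracket:
  "grading A V \<Longrightarrow> a \<in> carrier A \<Longrightarrow> b \<in> carrier A \<Longrightarrow> x \<in> V a \<Longrightarrow> y \<in> V b \<Longrightarrow>
    bracket x y \<in> V (a \<otimes>\<^bsub>A\<^esub> b)"
  unfolding grading_def by (elim conjE) (drule (1) bspec)+

lemma weight_obtain:
  assumes "grading A V" "a \<in> weights A V"
  obtains x where "x \<in> V a" "x \<noteq> 0"
proof -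
  have "0 \<in> V a" "V a \<noteq> {0}"
    using assms(2) grading_zero_mem[OF assms(1)] by (simp_all add: weights_def)
  then show thesis using that by blast
qed

lemma bracket_zero [simp]: "bracket 0 y = 0" "bracket x 0 = 0"
  using module_hom.zero[OF Vector_Spaces.linear.axioms(3)[OF linear_bracket_left[of y]]]
    module_hom.zero[OF Vector_Spaces.linear.axioms(3)[OF linear_bracket_right[of x]]]
  by simp_all

text \<open>The other elements in the fibre of \<open>g a\<close> are not weights, so their layers
  are zero and add nothing to the span.\<close>

lemma pushforward_at_weight:
  assumes "grading U V" "inj_on g (weights U V)" "a \<in> weights U V"
  shows "pushforward U g V (g a) = V a"
proof -
  have a: "a \<in> carrier U" using assms(3) by (simp add: weights_def)
  have "V d \<subseteq> V a" if "d \<in> carrier U" "g d = g a" for d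
  proof (cases "d \<in> weights U V")
    case True
    then show ?thesis using assms(2,3) that by (auto dest: inj_onD)
  next
    case False
    then show ?thesis using that grading_zero_mem[OF assms(1) a] by (auto simp: weights_def)
  qed
  then have "(\<Union>d\<in>{d \<in> carrier U. g d = g a}. V d) = V a" using a by auto
  then show ?thesis
    using grading_subspace[OF assms(1) a] by (simp add: pushforward_def span_eq_iff)
qed

lemma pushforward_off_weights:
  assumes "b \<notin> g ` weights U V"
  shows "pushforward U g V b = {0}"
proof -
  have "(\<Union>d\<in>{d \<in> carrier U. g d = b}. V d) \<subseteq> {0}" using assms by (auto simp: weights_def)
  then have "span (\<Union>d\<in>{d \<in> carrier U. g d = b}. V d) \<subseteq> span {0}" by (rule span_mono)
  then show ?thesis using span_zero by (auto simp: pushforward_def)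
qed

lemma layer_subset_pushforward: "a \<in> carrier U \<Longrightarrow> V a \<subseteq> pushforward U g V (g a)"
  unfolding pushforward_def by (rule subset_trans[OF _ span_superset]) auto

lemma direct_sum_decomposition_reindex:
  fixes g :: "'a \<Rightarrow> 'b"
  assumes V: "direct_sum_decomposition I V" and \<Omega>: "\<Omega> \<subseteq> I" "\<And>a. a \<in> I - \<Omega> \<Longrightarrow> V a = {0}"
    and g: "inj_on g \<Omega>" "g ` \<Omega> \<subseteq> J"
    and X: "\<And>a. a \<in> \<Omega> \<Longrightarrow> X (g a) = V a" "\<And>b. b \<in> J - g ` \<Omega> \<Longrightarrow> X b = {0}"
  shows "direct_sum_decomposition J X"
  unfolding direct_sum_decomposition_def
proof (intro conjI ballI allI)
  fix b assume "b \<in> J"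
  then show "subspace (X b)"
    using X \<Omega> direct_sum_subspace[OF V] subspace_single_0 by (cases "b \<in> g ` \<Omega>") auto
next
  fix x
  define P where "P c \<longleftrightarrow> (\<forall>a\<in>I. c a \<in> V a) \<and> (\<forall>a. a \<notin> I \<longrightarrow> c a = 0) \<and>
    finite {a. c a \<noteq> 0} \<and> x = (\<Sum>a | c a \<noteq> 0. c a)" for c
  define Q where "Q c \<longleftrightarrow> (\<forall>a\<in>J. c a \<in> X a) \<and> (\<forall>a. a \<notin> J \<longrightarrow> c a = 0) \<and>
    finite {a. c a \<noteq> 0} \<and> x = (\<Sum>a | c a \<noteq> 0. c a)" for c
  define h where "h = the_inv_into \<Omega> g"
  have h: "h (g a) = a" if "a \<in> \<Omega>" for a unfolding h_def by (rule the_inv_into_f_f[OF g(1) that])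
  have V0: "0 \<in> V a" if "a \<in> I" for a
    by (rule subspace_0[OF direct_sum_subspace[OF V that]])
  \<comment> \<open>\<open>\<Phi>\<close> transports families of components along \<open>g\<close>
    and \<open>\<Psi>\<close> pulls them back; components outside \<open>\<Omega>\<close> and its
    image vanish because the layers there are zero.\<close>
  define \<Phi> where "\<Phi> c b = (if b \<in> g ` \<Omega> then c (h b) else 0)" for c :: "'a \<Rightarrow> 'g" and b
  define \<Psi> where "\<Psi> c a = (if a \<in> \<Omega> then c (g a) else 0)" for c :: "'b \<Rightarrow> 'g" and a
  have supp: "{a. c a \<noteq> 0} \<subseteq> \<Omega>" if "P c" for c using that \<Omega>(2) by (force simp: P_def)
  have suppQ: "{b. c b \<noteq> 0} \<subseteq> g ` \<Omega>" if "Q c" for c using that X(2) by (force simp: Q_def)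
  have 1: "Q (\<Phi> c)" if c: "P c" for c
  proof -
    have eq: "{b. \<Phi> c b \<noteq> 0} = g ` {a. c a \<noteq> 0}"
    proof (intro equalityI subsetI)
      fix b assume "b \<in> {b. \<Phi> c b \<noteq> 0}"
      then obtain a where "a \<in> \<Omega>" "b = g a" "c (h b) \<noteq> 0" by (auto simp: \<Phi>_def split: if_splits)
      then show "b \<in> g ` {a. c a \<noteq> 0}" using h by auto
    next
      fix b assume "b \<in> g ` {a. c a \<noteq> 0}"
      then obtain a where a: "c a \<noteq> 0" "b = g a" by blast
      then have "a \<in> \<Omega>" using supp[OF c] by blast
      then show "b \<in> {b. \<Phi> c b \<noteq> 0}" using a h by (simp add: \<Phi>_def)
    qed
    have "(\<Sum>b | \<Phi> c b \<noteq> 0. \<Phi> c b) = (\<Sum>a | c a \<noteq> 0. \<Phi> c (g a))"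
      unfolding eq by (rule sum.reindex_cong[OF inj_on_subset[OF g(1) supp[OF c]]]) auto
    also have "\<dots> = (\<Sum>a | c a \<noteq> 0. c a)"
      using supp[OF c] h by (intro sum.cong refl) (auto simp: \<Phi>_def subset_iff)
    finally have "x = (\<Sum>b | \<Phi> c b \<noteq> 0. \<Phi> c b)" using c by (simp add: P_def)
    moreover have "finite {b. \<Phi> c b \<noteq> 0}" unfolding eq using c by (simp add: P_def)
    moreover have "\<Phi> c b \<in> X b" if "b \<in> J" for b
      using that X h c \<Omega> by (auto simp: \<Phi>_def P_def)
    ultimately show ?thesis using g(2) by (auto simp: Q_def \<Phi>_def)
  qed
  have 2: "P (\<Psi> c)" if c: "Q c" for c
  proof -
    have eq: "{b. c b \<noteq> 0} = g ` {a. \<Psi> c a \<noteq> 0}"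
      using suppQ[OF c] by (auto simp: \<Psi>_def)
    have sub: "{a. \<Psi> c a \<noteq> 0} \<subseteq> \<Omega>" by (auto simp: \<Psi>_def)
    have inj: "inj_on g {a. \<Psi> c a \<noteq> 0}" by (rule inj_on_subset[OF g(1) sub])
    have "(\<Sum>b | c b \<noteq> 0. c b) = (\<Sum>a | \<Psi> c a \<noteq> 0. \<Psi> c a)"
      unfolding eq by (rule sum.reindex_cong[OF inj]) (use sub in \<open>auto simp: \<Psi>_def\<close>)
    moreover have "finite {a. \<Psi> c a \<noteq> 0}"
      using c inj by (simp add: Q_def eq finite_image_iff)
    moreover have "\<Psi> c a \<in> V a" if "a \<in> I" for a
      using that X(1)[of a] g c V0 by (auto simp: \<Psi>_def Q_def)
    ultimately show ?thesis using c \<Omega>(1) by (auto simp: P_def Q_def \<Psi>_def)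
  qed
  \<comment> \<open>With uniqueness over \<open>I\<close> this composition suffices: a decomposition
    \<open>c\<close> over \<open>J\<close> equals \<open>\<Phi> (\<Psi> c)\<close>, and
    \<open>\<Psi> c\<close> is the unique decomposition \<open>c0\<close> over
    \<open>I\<close>.\<close>
  have 3: "\<Phi> (\<Psi> c) = c" if "Q c" for c
  proof
    fix b
    show "\<Phi> (\<Psi> c) b = c b" using suppQ[OF that] h by (auto simp: \<Phi>_def \<Psi>_def)
  qed
  have "\<exists>!c. P c" using V by (simp add: direct_sum_decomposition_def P_def)
  then obtain c0 where c0: "P c0" "\<And>c. P c \<Longrightarrow> c = c0" by blast
  have "\<exists>!c. Q c"
  proof (rule ex1I)
    show "Q (\<Phi> c0)" by (rule 1[OF c0(1)])
    fix c assume c: "Q c"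
    show "c = \<Phi> c0" using 3[OF c] c0(2)[OF 2[OF c]] by simp
  qed
  then show "\<exists>!c. (\<forall>a\<in>J. c a \<in> X a) \<and> (\<forall>a. a \<notin> J \<longrightarrow> c a = 0) \<and>
    finite {a. c a \<noteq> 0} \<and> x = (\<Sum>a | c a \<noteq> 0. c a)" by (simp add: Q_def)
qed

text \<open>Only the non-vanishing brackets constrain a relabelling of the weights.\<close>

definition respects_brackets ::
  "'a monoid \<Rightarrow> ('a \<Rightarrow> 'g set) \<Rightarrow> 'b monoid \<Rightarrow> ('a \<Rightarrow> 'b) \<Rightarrow> bool" where
  "respects_brackets U V B g \<longleftrightarrow>
     (\<forall>a\<in>weights U V. \<forall>b\<in>weights U V. (\<exists>x\<in>V a. \<exists>y\<in>V b. bracket x y \<noteq> 0) \<longrightarrow>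
        g (a \<otimes>\<^bsub>U\<^esub> b) = g a \<otimes>\<^bsub>B\<^esub> g b)"

lemma bracket_nonzero_weight:
  assumes "grading U V" "a \<in> weights U V" "b \<in> weights U V" "x \<in> V a" "y \<in> V b" "bracket x y \<noteq> 0"
  shows "a \<otimes>\<^bsub>U\<^esub> b \<in> weights U V"
proof -
  interpret comm_group U using assms(1) by (simp add: grading_def)
  have "a \<in> carrier U" "b \<in> carrier U" using assms(2,3) by (simp_all add: weights_def)
  then show ?thesis using grading_bracket[OF assms(1) _ _ assms(4,5)] assms(6) by (auto simp: weights_def)
qed

lemma weights_pushforward:
  assumes "grading U V" "inj_on g (weights U V)" "g ` weights U V \<subseteq> carrier B"
  shows "weights B (pushforward U g V) = g ` weights U V"
proof -
  have "pushforward U g V (g a) \<noteq> {0}" if "a \<in> weights U V" for a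
    using pushforward_at_weight[OF assms(1,2) that] that by (simp add: weights_def)
  then show ?thesis
    using assms(3) pushforward_off_weights[of _ g U V] by (auto simp: weights_def[of B])
qed

text \<open>For closure under brackets: a zero bracket lies in every layer, and a nonzero one comes
  from a pair of weights on which \<open>respects_brackets\<close> makes \<open>g\<close>
  multiplicative.\<close>

lemma realization_pushforward:
  assumes V: "grading U V" and B: "comm_group B"
    and g: "inj_on g (weights U V)" "g ` weights U V \<subseteq> carrier B" "respects_brackets U V B g"
  shows "realization U V B (pushforward U g V)"
proof -
  interpret B: comm_group B by (rule B)
  let ?X = "pushforward U g V"
  note at = pushforward_at_weight[OF V g(1)] and off = pushforward_off_weights[of _ g U V]
  have "direct_sum_decomposition (carrier B) ?X"
    by (rule direct_sum_decomposition_reindex[OF _ _ _ g(1,2)])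
      (use at off grading_direct_sum[OF V] in \<open>auto simp: weights_def\<close>)
  moreover have "bracket x y \<in> ?X (b \<otimes>\<^bsub>B\<^esub> d)"
    if bd: "b \<in> carrier B" "d \<in> carrier B" and x: "x \<in> ?X b" and y: "y \<in> ?X d" for b d x y
  proof (cases "bracket x y = 0")
    case True
    then show ?thesis by (simp add: pushforward_def span_zero)
  next
    case False
    then have "x \<noteq> 0" "y \<noteq> 0" by auto
    then obtain a c where a: "a \<in> weights U V" "b = g a" and c: "c \<in> weights U V" "d = g c"
      using x y off by blast
    have xy: "x \<in> V a" "y \<in> V c" using x y a c at by auto
    have "a \<otimes>\<^bsub>U\<^esub> c \<in> weights U V" by (rule bracket_nonzero_weight[OF V a(1) c(1) xy False])
    moreover have "g (a \<otimes>\<^bsub>U\<^esub> c) = b \<otimes>\<^bsub>B\<^esub> d"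
      using g(3) a c xy False unfolding respects_brackets_def by blast
    ultimately have "?X (b \<otimes>\<^bsub>B\<^esub> d) = V (a \<otimes>\<^bsub>U\<^esub> c)" using at by fastforce
    then show ?thesis using grading_bracket[OF V _ _ xy] a(1) c(1) by (simp add: weights_def)
  qed
  ultimately have "grading B ?X" using B by (simp add: grading_def)
  then show ?thesis
    unfolding realization_def
    by (intro conjI exI[of _ g] ballI g(1,2)) (simp_all add: at off)
qed

section \<open>Composition and comparison of realizations\<close>

lemma realization_weights:
  assumes "realization A V B W"
  obtains f where "bij_betw f (weights A V) (weights B W)" "\<And>a. a \<in> weights A V \<Longrightarrow> W (f a) = V a"
proof -
  obtain f where f: "inj_on f (weights A V)" "f ` weights A V \<subseteq> carrier B"
    "\<forall>a\<in>weights A V. W (f a) = V a" "\<forall>b\<in>carrier B - f ` weights A V. W b = {0}"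
    using assms by (auto simp: realization_def)
  then have "f ` weights A V = weights B W" by (fastforce simp: weights_def)
  then show thesis using f by (intro that[of f]) (auto simp: bij_betw_def)
qed

lemma realization_trans:
  assumes "realization A V U Y" "realization U Y B W"
  shows "realization A V B W"
proof -
  obtain f where f: "bij_betw f (weights A V) (weights U Y)" "\<And>a. a \<in> weights A V \<Longrightarrow> Y (f a) = V a"
    using realization_weights[OF assms(1)] by blast
  obtain h where h: "bij_betw h (weights U Y) (weights B W)" "\<And>a. a \<in> weights U Y \<Longrightarrow> W (h a) = Y a"
    using realization_weights[OF assms(2)] by blast
  have hf: "bij_betw (h \<circ> f) (weights A V) (weights B W)" by (rule bij_betw_trans[OF f(1) h(1)])
  show ?thesis
    unfolding realization_def
  proof (intro conjI exI[of _ "h \<circ> f"])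
    show "grading B W" using assms(2) by (simp add: realization_def)
    show "inj_on (h \<circ> f) (weights A V)" using hf by (simp add: bij_betw_def)
    show "(h \<circ> f) ` weights A V \<subseteq> carrier B" using hf by (auto simp: bij_betw_def weights_def)
    show "\<forall>a\<in>weights A V. W ((h \<circ> f) a) = V a" using f h by (simp add: bij_betw_def image_iff) blast
    show "\<forall>b\<in>carrier B - (h \<circ> f) ` weights A V. W b = {0}"
      using hf by (auto simp: bij_betw_def weights_def)
  qed
qed

text \<open>A kind of converse to \<open>realization_pushforward\<close>. A nonzero bracket of
  elements of \<open>Y a\<close> and \<open>Y b\<close> lies in the layers of \<open>W\<close> at
  \<open>h (a \<otimes> b)\<close> and at \<open>h a \<otimes> h b\<close>, and distinct layers meet
  only in 0.\<close>

lemma realizations_relabelling: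
  assumes Y: "realization A V U Y" and W: "realization A V B W"
  obtains h where "bij_betw h (weights U Y) (weights B W)"
    "\<And>a. a \<in> weights U Y \<Longrightarrow> W (h a) = Y a" "respects_brackets U Y B h"
proof -
  obtain f where f: "bij_betw f (weights A V) (weights U Y)" "\<And>a. a \<in> weights A V \<Longrightarrow> Y (f a) = V a"
    using realization_weights[OF Y] by blast
  obtain g where g: "bij_betw g (weights A V) (weights B W)" "\<And>a. a \<in> weights A V \<Longrightarrow> W (g a) = V a"
    using realization_weights[OF W] by blast
  have grU: "grading U Y" and grB: "grading B W" using Y W by (simp_all add: realization_def)
  interpret B: comm_group B using grB by (simp add: grading_def)
  define h where "h = g \<circ> inv_into (weights A V) f"
  have h: "bij_betw h (weights U Y) (weights B W)"
    unfolding h_def by (rule bij_betw_trans[OF bij_betw_inv_into[OF f(1)] g(1)])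
  have Wh: "W (h a) = Y a" if "a \<in> weights U Y" for a
  proof -
    obtain d where "d \<in> weights A V" "a = f d" using f(1) \<open>a \<in> weights U Y\<close> by (auto simp: bij_betw_def)
    then show ?thesis using f g by (simp add: h_def bij_betw_def inv_into_f_f)
  qed
  have hB: "h a \<in> carrier B" if "a \<in> weights U Y" for a
    using bij_betwE[OF h] that by (auto simp: weights_def)
  have "respects_brackets U Y B h"
    unfolding respects_brackets_def
  proof (intro ballI impI, elim bexE)
    fix a b x y
    assume a: "a \<in> weights U Y" and b: "b \<in> weights U Y" and x: "x \<in> Y a" and y: "y \<in> Y b"
      and nz: "bracket x y \<noteq> 0"
    have ab: "a \<otimes>\<^bsub>U\<^esub> b \<in> weights U Y" by (rule bracket_nonzero_weight[OF grU a b x y nz])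
    have "bracket x y \<in> Y (a \<otimes>\<^bsub>U\<^esub> b)" using grading_bracket[OF grU _ _ x y] a b by (simp add: weights_def)
    then have 1: "bracket x y \<in> W (h (a \<otimes>\<^bsub>U\<^esub> b))" using Wh ab by simp
    have 2: "bracket x y \<in> W (h a \<otimes>\<^bsub>B\<^esub> h b)"
      using grading_bracket[OF grB hB[OF a] hB[OF b]] Wh a b x y by simp
    show "h (a \<otimes>\<^bsub>U\<^esub> b) = h a \<otimes>\<^bsub>B\<^esub> h b"
      by (rule grading_unique[OF grB _ _ 1 2 nz]) (use hB ab a b in auto)
  qed
  then show thesis using that h Wh by blast
qed

end


section \<open>The integer linear program\<close>

lemma real_group_simps [simp]:
  "carrier real_group = UNIV" "x \<otimes>\<^bsub>real_group\<^esub> y = x + y" "\<one>\<^bsub>real_group\<^esub> = 0"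
  by (simp_all add: real_group_def)

lemma comm_group_real_group: "comm_group real_group"
proof (rule comm_groupI)
  fix x :: real
  show "\<exists>y\<in>carrier real_group. y \<otimes>\<^bsub>real_group\<^esub> x = \<one>\<^bsub>real_group\<^esub>"
    by (rule bexI[of _ "- x"]) simp_all
qed simp_all

lemma int_pow_group_simps [simp]:
  "carrier (int_pow_group k) = {..<k} \<rightarrow>\<^sub>E UNIV"
  "x \<otimes>\<^bsub>int_pow_group k\<^esub> y = (\<lambda>m\<in>{..<k}. x m + y m)"
  by (simp_all add: int_pow_group_def)

lemma int_inner_add: "int_inner k w (\<lambda>m\<in>{..<k}. x m + y m) = int_inner k w x + int_inner k w y"
  by (simp add: int_inner_def distrib_left sum.distrib)

lemma int_inner_diff: "int_inner k w (\<lambda>m. x m - y m) = int_inner k w x - int_inner k w y"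
  by (simp add: int_inner_def right_diff_distrib sum_subtractf)

lemma additive_int_linear:
  fixes f :: "int \<Rightarrow> int"
  assumes "\<And>s t. f (s + t) = f s + f t"
  shows "f t = f 1 * t"
proof (induction t rule: int_induct[where k = 0])
  case base
  show ?case using assms[of 0 0] by simp
next
  case (step1 i)
  then show ?case using assms[of i 1] by (simp add: algebra_simps)
next
  case (step2 i)
  then show ?case using assms[of "i - 1" 1] by (simp add: algebra_simps)
qed

lemma hom_int_pow_group_eq_inner:
  assumes f: "\<And>x y. x \<in> carrier (int_pow_group k) \<Longrightarrow> y \<in> carrier (int_pow_group k) \<Longrightarrow>
    f (x \<otimes>\<^bsub>int_pow_group k\<^esub> y) = f x + (f y :: int)"
  obtains w where "w \<in> carrier (int_pow_group k)"
    "\<And>y. y \<in> carrier (int_pow_group k) \<Longrightarrow> f y = int_inner k w y"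
proof -
  \<comment> \<open>For \<open>m < k\<close>, \<open>t\<close> times the \<open>m\<close>-th unit
    vector, restricted so that it belongs to the carrier; \<open>w\<close> will collect the values
    of \<open>f\<close> on unit vectors.\<close>
  define E where "E m t = (\<lambda>i\<in>{..<k}. if i = m then t else 0)" for m and t :: int
  have E: "f (E m t) = f (E m 1) * t" for m t
  proof (rule additive_int_linear)
    fix s t :: int
    have "E m (s + t) = (\<lambda>i\<in>{..<k}. E m s i + E m t i)" by (auto simp: E_def)
    then show "f (E m (s + t)) = f (E m s) + f (E m t)" using f[of "E m s" "E m t"] by (simp add: E_def)
  qed
  define w where "w = (\<lambda>m\<in>{..<k}. f (E m 1))"
  have "f y = int_inner k w y" if y: "y \<in> carrier (int_pow_group k)" for y
  proof -
    \<comment> \<open>Truncations of \<open>y\<close> to its first \<open>n\<close> coordinates;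
      consecutive ones differ by a multiple of one unit vector.\<close>
    define T where "T n = (\<lambda>i\<in>{..<k}. if i < n then y i else 0)" for n
    have fT: "f (T n) = (\<Sum>m<n. f (E m 1) * y m)" if "n \<le> k" for n
      using that
    proof (induction n)
      case 0
      have "T 0 \<otimes>\<^bsub>int_pow_group k\<^esub> T 0 = T 0" by (auto simp: T_def)
      moreover have "f (T 0 \<otimes>\<^bsub>int_pow_group k\<^esub> T 0) = f (T 0) + f (T 0)"
        by (rule f) (simp_all add: T_def)
      ultimately show ?case by simp
    next
      case (Suc n)
      have "T (Suc n) = (\<lambda>i\<in>{..<k}. T n i + E n (y n) i)"
        by (auto simp: T_def E_def less_Suc_eq)
      then have "f (T (Suc n)) = f (T n) + f (E n (y n))"
        using f[of "T n" "E n (y n)"] by (simp add: T_def E_def)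
      then show ?case using Suc E[of n "y n"] by simp
    qed
    have "T k = y" using y by (auto simp: T_def PiE_iff extensional_def)
    then show ?thesis using fT[of k] by (simp add: int_inner_def w_def)
  qed
  moreover have "w \<in> carrier (int_pow_group k)" by (simp add: w_def)
  ultimately show thesis using that by blast
qed

section \<open>Base expansions and the constants of the program\<close>

text \<open>The digits are signed. The terms below position \<open>k\<close> total less than
  \<open>M ^ k\<close> in absolute value, so they cannot cancel a nonzero digit at position
  \<open>k\<close>.\<close>

lemma base_expansion_bound:
  fixes d :: "nat \<Rightarrow> int"
  assumes M: "1 \<le> M" and "\<And>m. m < k \<Longrightarrow> \<bar>d m\<bar> \<le> M - 1"
  shows "\<bar>\<Sum>m<k. M ^ m * d m\<bar> \<le> M ^ k - 1"
    and "(\<Sum>m<k. M ^ m * d m) = 0 \<Longrightarrow> \<forall>m<k. d m = 0"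
proof -
  have "\<bar>\<Sum>m<k. M ^ m * d m\<bar> \<le> M ^ k - 1 \<and> ((\<Sum>m<k. M ^ m * d m) = 0 \<longrightarrow> (\<forall>m<k. d m = 0))"
    using assms(2)
  proof (induction k)
    case 0
    then show ?case by simp
  next
    case (Suc k)
    let ?S = "\<Sum>m<k. M ^ m * d m"
    have IH: "\<bar>?S\<bar> \<le> M ^ k - 1" "?S = 0 \<longrightarrow> (\<forall>m<k. d m = 0)"
      using Suc.IH[OF Suc.prems[OF less_SucI]] by blast+
    have abs: "\<bar>M ^ k * d k\<bar> = M ^ k * \<bar>d k\<bar>"
      unfolding abs_mult using M by (simp add: zero_le_power)
    have "M ^ k * \<bar>d k\<bar> \<le> M ^ k * (M - 1)"
      by (rule mult_left_mono) (use M Suc.prems[of k] in simp_all)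
    then have top: "\<bar>M ^ k * d k\<bar> \<le> M ^ Suc k - M ^ k"
      unfolding abs by (simp add: algebra_simps)
    have "\<bar>?S + M ^ k * d k\<bar> \<le> \<bar>?S\<bar> + \<bar>M ^ k * d k\<bar>" by (rule abs_triangle_ineq)
    also have "\<dots> \<le> (M ^ k - 1) + (M ^ Suc k - M ^ k)" by (rule add_mono[OF IH(1) top])
    finally have 1: "\<bar>?S + M ^ k * d k\<bar> \<le> M ^ Suc k - 1" by simp
    have 2: "\<forall>m<Suc k. d m = 0" if z: "?S + M ^ k * d k = 0"
    proof -
      have "d k = 0"
      proof (rule ccontr)
        assume "d k \<noteq> 0"
        then have "M ^ k * 1 \<le> \<bar>M ^ k * d k\<bar>"
          unfolding abs by (intro mult_left_mono) (use M in auto)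
        also have "\<dots> = \<bar>?S\<bar>" using z by (simp only: eq_neg_iff_add_eq_0[symmetric] abs_minus_cancel)
        also note IH(1)
        finally show False by simp
      qed
      moreover from this have "?S = 0" using z by simp
      then have "\<forall>m<k. d m = 0" using IH(2) by blast
      ultimately show ?thesis by (auto simp: less_Suc_eq)
    qed
    show ?case unfolding sum.lessThan_Suc by (intro conjI impI 1 2)
  qed
  then show "\<bar>\<Sum>m<k. M ^ m * d m\<bar> \<le> M ^ k - 1"
    and "(\<Sum>m<k. M ^ m * d m) = 0 \<Longrightarrow> \<forall>m<k. d m = 0"
    by (rule conjunct1, rule conjunct2[THEN mp])
qed

lemma abs_le_int_sup_norm: "m < k \<Longrightarrow> \<bar>x m\<bar> \<le> int_sup_norm k x"
  unfolding int_sup_norm_def by (rule Max_ge[OF _ insertI2[OF imageI]]) simp_all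

text \<open>The summand 1 in \<open>ilp_M\<close> makes the coordinates of the weights and of their
  differences admissible digits for \<open>base_expansion_bound\<close>.\<close>

lemma ilp_M_bounds:
  assumes i: "i \<in> {1..N}"
  shows "m < k \<Longrightarrow> \<bar>\<alpha> i m\<bar> \<le> ilp_M k N \<alpha> - 1"
    and "j \<in> {1..N} \<Longrightarrow> m < k \<Longrightarrow> \<bar>\<alpha> i m - \<alpha> j m\<bar> \<le> ilp_M k N \<alpha> - 1"
    and "1 \<le> ilp_M k N \<alpha>"
proof -
  let ?S1 = "{int_sup_norm k (\<lambda>m. \<alpha> i m - \<alpha> j m) | i j. i \<in> {1..N} \<and> j \<in> {1..N}}"
  let ?S2 = "{int_sup_norm k (\<alpha> i) | i. i \<in> {1..N}}"
  have "?S1 \<subseteq> (\<lambda>(i,j). int_sup_norm k (\<lambda>m. \<alpha> i m - \<alpha> j m)) ` ({1..N} \<times> {1..N})" by auto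
  then have fin1: "finite ?S1" by (rule finite_subset) simp
  have "?S2 = (\<lambda>i. int_sup_norm k (\<alpha> i)) ` {1..N}" by auto
  then have fin2: "finite ?S2" by simp
  have 1: "int_sup_norm k (\<lambda>m. \<alpha> i m - \<alpha> j m) \<le> ilp_M k N \<alpha> - 1" if "j \<in> {1..N}" for j
  proof -
    have "int_sup_norm k (\<lambda>m. \<alpha> i m - \<alpha> j m) \<le> Max ?S1"
      using fin1 by (rule Max_ge) (use i that in blast)
    then show ?thesis by (simp add: ilp_M_def)
  qed
  have "int_sup_norm k (\<alpha> i) \<le> Max ?S2" using fin2 by (rule Max_ge) (use i in blast)
  then have 2: "int_sup_norm k (\<alpha> i) \<le> ilp_M k N \<alpha> - 1" by (simp add: ilp_M_def)
  show "\<bar>\<alpha> i m\<bar> \<le> ilp_M k N \<alpha> - 1" if "m < k" using abs_le_int_sup_norm[OF that, of "\<alpha> i"] 2 by linarith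
  show "\<bar>\<alpha> i m - \<alpha> j m\<bar> \<le> ilp_M k N \<alpha> - 1" if "j \<in> {1..N}" "m < k"
    using abs_le_int_sup_norm[OF that(2), of "\<lambda>m. \<alpha> i m - \<alpha> j m"] 1[OF that(1)] by linarith
  have "0 \<le> int_sup_norm k (\<alpha> i)"
    unfolding int_sup_norm_def by (rule Max_ge[OF _ insertI1]) simp
  then show "1 \<le> ilp_M k N \<alpha>" using 2 by simp
qed

section \<open>Injectivity expressed by binary variables\<close>

text \<open>The variables \<open>b i j\<close> record the order of the values. Values between 1 and
  \<open>z \<le> ilp_C k N \<alpha> + 1\<close> differ by at most \<open>ilp_C k N \<alpha>\<close>,
  so the constraint that \<open>b i j\<close> switches off holds as well.\<close>

lemma ex_ilp_feasible:
  assumes "w \<in> carrier (int_pow_group k)"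
    and "\<And>i. i \<in> {1..N} \<Longrightarrow> 1 \<le> int_inner k w (\<alpha> i) \<and> int_inner k w (\<alpha> i) \<le> z"
    and "inj_on (\<lambda>i. int_inner k w (\<alpha> i)) {1..N}" and "z \<le> ilp_C k N \<alpha> + 1"
  shows "\<exists>b. ilp_feasible k N \<alpha> z w b"
proof -
  define b :: "nat \<Rightarrow> nat \<Rightarrow> int"
    where "b i j = (if int_inner k w (\<alpha> j) < int_inner k w (\<alpha> i) then 1 else 0)" for i j
  have "ilp_feasible k N \<alpha> z w b"
    unfolding ilp_feasible_def int_inner_diff
  proof (intro conjI ballI impI)
    fix i j assume i: "i \<in> {1..N}" and j: "j \<in> {1..N}" and ij: "i < j"
    have ne: "int_inner k w (\<alpha> i) \<noteq> int_inner k w (\<alpha> j)" using assms(3) i j ij by (auto dest: inj_onD)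
    show "b i j \<in> {0, 1}" by (simp add: b_def)
    show "b i j - ilp_C k N \<alpha> * (1 - b i j) \<le> int_inner k w (\<alpha> i) - int_inner k w (\<alpha> j)"
      using assms(2)[OF i] assms(2)[OF j] assms(4) ne by (auto simp: b_def)
    show "int_inner k w (\<alpha> i) - int_inner k w (\<alpha> j) \<le> b i j - 1 + ilp_C k N \<alpha> * b i j"
      using assms(2)[OF i] assms(2)[OF j] assms(4) ne by (auto simp: b_def)
  qed (use assms in auto)
  then show ?thesis by blast
qed

text \<open>\<open>b i j = 1\<close> forces the difference of the two values to be at least 1, and
  \<open>b i j = 0\<close> forces it to be at most -1.\<close>

lemma ilp_feasible_inj_on:
  assumes f: "ilp_feasible k N \<alpha> z w b"
  shows "inj_on (\<lambda>i. int_inner k w (\<alpha> i)) {1..N}"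
proof -
  have "int_inner k w (\<alpha> i) \<noteq> int_inner k w (\<alpha> j)" if "i \<in> {1..N}" "j \<in> {1..N}" "i < j" for i j
  proof -
    have "\<forall>i\<in>{1..N}. \<forall>j\<in>{1..N}. i < j \<longrightarrow> b i j \<in> {0, 1} \<and>
        b i j - ilp_C k N \<alpha> * (1 - b i j) \<le> int_inner k w (\<alpha> i) - int_inner k w (\<alpha> j) \<and>
        int_inner k w (\<alpha> i) - int_inner k w (\<alpha> j) \<le> b i j - 1 + ilp_C k N \<alpha> * b i j"
      using f unfolding ilp_feasible_def int_inner_diff by (elim conjE)
    note this[rule_format, OF that]
    then show ?thesis by auto
  qed
  then show ?thesis by (intro inj_onI) (metis nat_neq_iff)
qed


section \<open>Realizations and feasible points\<close>

context lie_algebra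
begin

text \<open>The universal property is applied to a copy of \<open>\<int>\<close> inside the test type.\<close>

lemma universal_realization_integer_labelling:
  fixes Y :: "(nat \<Rightarrow> int) \<Rightarrow> 'g set"
  assumes inf: "infinite (UNIV :: 'u set)"
    and univ: "universal_realization TYPE('u) A V (int_pow_group k) Y"
    and inj: "inj_on x (weights (int_pow_group k) Y)"
    and resp: "respects_brackets (int_pow_group k) Y integer_group x"
  obtains w where "w \<in> carrier (int_pow_group k)"
    "\<And>a. a \<in> weights (int_pow_group k) Y \<Longrightarrow> int_inner k w a = x a"
proof -
  let ?U = "int_pow_group k"
  obtain u :: "nat \<Rightarrow> 'u" where u: "inj u"
    using infinite_countable_subset[OF inf] by blast
  \<comment> \<open>An infinite type contains a copy of the naturals, hence by
    \<open>int_encode\<close> one of the integers; \<open>B\<close> carries the transported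
    addition.\<close>
  define \<iota> :: "int \<Rightarrow> 'u" where "\<iota> = u \<circ> int_encode"
  have \<iota>: "inj \<iota>" unfolding \<iota>_def by (intro inj_compose u inj_int_encode)
  define \<pi> where "\<pi> = inv_into UNIV \<iota>"
  have \<pi>\<iota> [simp]: "\<pi> (\<iota> t) = t" for t unfolding \<pi>_def by (rule inv_f_f[OF \<iota>])
  define B :: "'u monoid"
    where "B = \<lparr>carrier = range \<iota>, monoid.mult = (\<lambda>p q. \<iota> (\<pi> p + \<pi> q)), one = \<iota> 0\<rparr>"
  have B_simps: "carrier B = range \<iota>" "p \<otimes>\<^bsub>B\<^esub> q = \<iota> (\<pi> p + \<pi> q)" "\<one>\<^bsub>B\<^esub> = \<iota> 0" for p q
    by (simp_all add: B_def)
  have B: "comm_group B"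
  proof (rule comm_groupI)
    fix p assume "p \<in> carrier B"
    then obtain t where "p = \<iota> t" by (auto simp: B_simps)
    then show "\<exists>q\<in>carrier B. q \<otimes>\<^bsub>B\<^esub> p = \<one>\<^bsub>B\<^esub>"
      by (intro bexI[of _ "\<iota> (- t)"]) (simp_all add: B_simps)
  qed (auto simp: B_simps algebra_simps)
  have Y: "realization A V ?U Y" using univ by (simp add: universal_realization_def)
  then have grY: "grading ?U Y" by (simp add: realization_def)
  define g where "g a = \<iota> (x a)" for a
  have g: "inj_on g (weights ?U Y)" "g ` weights ?U Y \<subseteq> carrier B"
    using inj \<iota> by (auto simp: inj_on_def g_def B_simps)
  have "respects_brackets ?U Y B g"
    using resp by (simp add: respects_brackets_def g_def B_simps)
  then have X: "realization ?U Y B (pushforward ?U g Y)"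
    by (rule realization_pushforward[OF grY B g])
  then have grX: "grading B (pushforward ?U g Y)" by (simp add: realization_def)
  obtain f where f: "f \<in> hom ?U B"
    "\<And>b. b \<in> carrier B \<Longrightarrow> pushforward ?U g Y b = pushforward ?U f Y b"
    using univ realization_trans[OF Y X] unfolding universal_realization_def by blast
  have fB: "f a \<in> carrier B" if "a \<in> carrier ?U" for a
    by (rule hom_in_carrier[OF f(1) that])
  \<comment> \<open>The push-forwards along \<open>f\<close> and \<open>g\<close> agree, so the
    nonzero layer \<open>Y a\<close> lies in the layers at \<open>f a\<close> and at
    \<open>g a\<close> of one grading.\<close>
  have fg: "f a = g a" if a: "a \<in> weights ?U Y" for a
  proof -
    obtain y where y: "y \<in> Y a" "y \<noteq> 0" using weight_obtain[OF grY a] by blast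
    have aU: "a \<in> carrier ?U" using a by (simp add: weights_def)
    have 1: "y \<in> pushforward ?U g Y (f a)"
      using layer_subset_pushforward[OF aU, of Y f] y f(2)[OF fB[OF aU]] by blast
    have 2: "y \<in> pushforward ?U g Y (g a)"
      using layer_subset_pushforward[OF aU, of Y g] y by blast
    have "g a \<in> carrier B" using g(2) a by blast
    then show ?thesis by (rule grading_unique[OF grX fB[OF aU] _ 1 2 y(2)])
  qed
  have "\<pi> (f (a \<otimes>\<^bsub>?U\<^esub> b)) = \<pi> (f a) + \<pi> (f b)" if "a \<in> carrier ?U" "b \<in> carrier ?U" for a b
    using hom_mult[OF f(1) that] by (simp add: B_simps)
  then obtain w where w: "w \<in> carrier ?U" "\<And>y. y \<in> carrier ?U \<Longrightarrow> \<pi> (f y) = int_inner k w y"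
    using hom_int_pow_group_eq_inner[of k "\<lambda>a. \<pi> (f a)"] by blast
  have "int_inner k w a = x a" if a: "a \<in> weights ?U Y" for a
    using w(2)[of a] fg[OF a] a by (simp add: weights_def g_def)
  then show thesis using that w(1) by blast
qed

text \<open>The point serves twice: it shows that the program is feasible, and it caps the optimal
  value at \<open>ilp_C k N \<alpha> + 1\<close>.\<close>

lemma positive_realization_ex_small_ilp_feasible:
  fixes Y :: "(nat \<Rightarrow> int) \<Rightarrow> 'g set"
  assumes inf: "infinite (UNIV :: 'u set)"
    and univ: "universal_realization TYPE('u) A V (int_pow_group k) Y"
    and N: "1 \<le> N" and enum: "bij_betw \<alpha> {1..N} (weights (int_pow_group k) Y)"
    and W: "positive_realization A V W"
  shows "\<exists>w b. ilp_feasible k N \<alpha> (ilp_C k N \<alpha> + 1) w b"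
proof -
  let ?U = "int_pow_group k"
  have Y: "realization A V ?U Y" using univ by (simp add: universal_realization_def)
  then have grY: "grading ?U Y" by (simp add: realization_def)
  have W': "realization A V real_group W" "\<And>r. r \<in> weights real_group W \<Longrightarrow> 0 < r"
    using W by (simp_all add: positive_realization_def)
  obtain h where h: "bij_betw h (weights ?U Y) (weights real_group W)"
    "respects_brackets ?U Y real_group h"
    using realizations_relabelling[OF Y W'(1)] by blast
  have \<alpha>: "\<alpha> i \<in> weights ?U Y" if "i \<in> {1..N}" for i using bij_betwE[OF enum] that by blast
  \<comment> \<open>The relations from non-vanishing brackets. Indices here start at 0 while
    \<open>\<alpha>\<close> is enumerated from 1, hence the \<open>Suc\<close> and the
    \<open>- 1\<close> in \<open>idx\<close>.\<close>
  define R where "R = {(i,j,l). i < N \<and> j < N \<and> l < N \<and> \<alpha> (Suc l) = \<alpha> (Suc i) \<otimes>\<^bsub>?U\<^esub> \<alpha> (Suc j) \<and>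
    (\<exists>p\<in>Y (\<alpha> (Suc i)). \<exists>q\<in>Y (\<alpha> (Suc j)). bracket p q \<noteq> 0)}"
  have Rsub: "R \<subseteq> {..<N} \<times> {..<N} \<times> {..<N}" by (auto simp: R_def)
  have hpos: "0 < h (\<alpha> (Suc i))" if "i < N" for i
    using W'(2) bij_betwE[OF h(1)] \<alpha>[of "Suc i"] that by simp
  have hR: "h (\<alpha> (Suc i)) + h (\<alpha> (Suc j)) = h (\<alpha> (Suc l))" if "(i,j,l) \<in> R" for i j l
    using that h(2) \<alpha>[of "Suc i"] \<alpha>[of "Suc j"] by (auto simp: R_def respects_brackets_def)
  obtain y :: "nat \<Rightarrow> int" where y: "\<And>i. i < N \<Longrightarrow> 1 \<le> y i \<and> y i \<le> 2 ^ N"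
    "\<And>i j l. (i,j,l) \<in> R \<Longrightarrow> y i + y j = y l"
    using additive_system_small_integer_solution[of R N "\<lambda>i. h (\<alpha> (Suc i))", OF Rsub hpos hR] by blast
  define M where "M = ilp_M k N \<alpha>"
  define w0 where "w0 m = M ^ m" for m
  define idx where "idx a = inv_into {1..N} \<alpha> a - 1" for a
  have idx: "idx (\<alpha> (Suc i)) = i" if "i < N" for i
    using enum that by (simp add: idx_def bij_betw_def inv_into_f_f)
  have M1: "1 \<le> M" unfolding M_def using ilp_M_bounds(3)[of 1 N] N by simp
  have small: "\<bar>int_inner k w0 (\<alpha> i)\<bar> \<le> M ^ k - 1" if "i \<in> {1..N}" for i
    unfolding int_inner_def w0_def M_def
    by (rule base_expansion_bound(1)) (use M1 that ilp_M_bounds(1) M_def in auto)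
  text \<open>The leading term is positive and respects the brackets; the perturbation by \<open>w0\<close>, smaller
    than \<open>M ^ k\<close>, separates the weights.\<close>
  define x where "x a = M ^ k * y (idx a) + int_inner k w0 a" for a
  have Mk: "1 \<le> M ^ k" using M1 by simp
  have weight_obt: "\<exists>i<N. a = \<alpha> (Suc i)" if "a \<in> weights ?U Y" for a
  proof -
    have "a \<in> \<alpha> ` {1..N}" using enum that by (simp add: bij_betw_def)
    then obtain i where "i \<in> {1..N}" "a = \<alpha> i" by blast
    then show ?thesis by (intro exI[of _ "i - 1"]) auto
  qed
  have "inj_on x (weights ?U Y)"
  proof (rule inj_onI)
    fix a b assume a: "a \<in> weights ?U Y" and b: "b \<in> weights ?U Y" and eq: "x a = x b"
    obtain i where i: "i < N" "a = \<alpha> (Suc i)" using weight_obt[OF a] by blast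
    obtain j where j: "j < N" "b = \<alpha> (Suc j)" using weight_obt[OF b] by blast
    let ?d = "\<lambda>m. a m - b m"
    have d: "\<bar>?d m\<bar> \<le> M - 1" if "m < k" for m
      unfolding M_def i j using ilp_M_bounds(2)[of "Suc i" N "Suc j" m k \<alpha>] i j that by simp
    note bound = base_expansion_bound[of M k ?d, OF M1 d]
    have sum: "(\<Sum>m<k. M ^ m * ?d m) = int_inner k w0 a - int_inner k w0 b"
      unfolding int_inner_diff[symmetric] by (simp add: int_inner_def w0_def)
    also have "\<dots> = M ^ k * (y j - y i)"
      using eq i j by (simp add: x_def idx right_diff_distrib)
    finally have sum': "(\<Sum>m<k. M ^ m * ?d m) = M ^ k * (y j - y i)" .
    \<comment> \<open>The digit sum is a multiple of \<open>M ^ k\<close> of absolute value below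
      \<open>M ^ k\<close>, hence 0. So the leading terms agree, and then all digits of
      \<open>a - b\<close> vanish.\<close>
    have "y j - y i = 0"
    proof (rule ccontr)
      assume "y j - y i \<noteq> 0"
      then have "M ^ k * 1 \<le> M ^ k * \<bar>y j - y i\<bar>" using Mk by (intro mult_left_mono) auto
      also have "\<dots> = \<bar>M ^ k * (y j - y i)\<bar>" using Mk by (simp add: abs_mult)
      finally show False using bound(1) sum' by simp
    qed
    then have "\<forall>m<k. a m = b m" using bound(2) sum' by simp
    moreover have "a \<in> {..<k} \<rightarrow>\<^sub>E UNIV" "b \<in> {..<k} \<rightarrow>\<^sub>E UNIV" using a b by (simp_all add: weights_def)
    ultimately show "a = b" by (intro PiE_ext[of a "{..<k}" "\<lambda>_. UNIV" b]) simp_all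
  qed
  moreover have "respects_brackets ?U Y integer_group x"
    unfolding respects_brackets_def
  proof (intro ballI impI)
    fix a b assume a: "a \<in> weights ?U Y" and b: "b \<in> weights ?U Y"
      and nz: "\<exists>p\<in>Y a. \<exists>q\<in>Y b. bracket p q \<noteq> 0"
    obtain i where i: "i < N" "a = \<alpha> (Suc i)" using weight_obt[OF a] by blast
    obtain j where j: "j < N" "b = \<alpha> (Suc j)" using weight_obt[OF b] by blast
    have "a \<otimes>\<^bsub>?U\<^esub> b \<in> weights ?U Y" using bracket_nonzero_weight[OF grY a b] nz by blast
    then obtain l where l: "l < N" "a \<otimes>\<^bsub>?U\<^esub> b = \<alpha> (Suc l)" using weight_obt by blast
    have "(i,j,l) \<in> R" using i j l nz by (auto simp: R_def)
    have "idx a = i" "idx b = j" "idx (a \<otimes>\<^bsub>?U\<^esub> b) = l"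
      unfolding i(2) j(2) l(2)[unfolded i(2) j(2)] by (rule idx[OF i(1)] idx[OF j(1)] idx[OF l(1)])+
    then have "y (idx (a \<otimes>\<^bsub>?U\<^esub> b)) = y (idx a) + y (idx b)"
      using y(2)[OF \<open>(i,j,l) \<in> R\<close>] by (simp only:)
    moreover have "int_inner k w0 (a \<otimes>\<^bsub>?U\<^esub> b) = int_inner k w0 a + int_inner k w0 b"
      by (simp add: int_inner_add)
    ultimately show "x (a \<otimes>\<^bsub>?U\<^esub> b) = x a \<otimes>\<^bsub>integer_group\<^esub> x b"
      by (simp only: x_def mult_integer_group distrib_left)
  qed
  ultimately obtain w where w: "w \<in> carrier ?U"
    "\<And>a. a \<in> weights ?U Y \<Longrightarrow> int_inner k w a = x a"
    using universal_realization_integer_labelling[OF inf univ] by blast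
  have "\<exists>b. ilp_feasible k N \<alpha> (ilp_C k N \<alpha> + 1) w b"
  proof (rule ex_ilp_feasible[OF w(1)])
    fix i assume i: "i \<in> {1..N}"
    then obtain i' where i': "i = Suc i'" "i' < N" by (cases i) auto
    have wi: "int_inner k w (\<alpha> i) = M ^ k * y i' + int_inner k w0 (\<alpha> i)"
      using w(2)[OF \<alpha>[OF i]] i' by (simp add: x_def idx)
    have "M ^ k * 1 \<le> M ^ k * y i'" using Mk y(1)[OF i'(2)] by (intro mult_left_mono) auto
    then have lower: "1 \<le> int_inner k w (\<alpha> i)" using wi small[OF i] by linarith
    \<comment> \<open>The label is less than \<open>M ^ k * 2 ^ N + M ^ k\<close>. The term with
      \<open>N * 2 ^ (N + 1)\<close> in \<open>ilp_C\<close> absorbs the first summand, and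
      \<open>3 * M ^ k\<close> absorbs the second.\<close>
    have "y i' \<le> 2 ^ N" using y(1)[OF i'(2)] by simp
    also have "\<dots> \<le> 2 ^ (N + 1)" by simp
    also have "\<dots> = 1 * 2 ^ (N + 1)" by simp
    also have "\<dots> \<le> int N * 2 ^ (N + 1)" using N by (intro mult_right_mono) auto
    finally have "M ^ k * y i' \<le> M ^ k * (int N * 2 ^ (N + 1))"
      using Mk by (intro mult_left_mono) auto
    moreover have "ilp_C k N \<alpha> = 3 * M ^ k + M ^ k * (int N * 2 ^ (N + 1))"
      by (simp add: ilp_C_def M_def algebra_simps)
    ultimately have "int_inner k w (\<alpha> i) \<le> ilp_C k N \<alpha> + 1" using wi small[OF i] Mk by linarith
    with lower show "1 \<le> int_inner k w (\<alpha> i) \<and> int_inner k w (\<alpha> i) \<le> ilp_C k N \<alpha> + 1" ..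
  next
    show "inj_on (\<lambda>i. int_inner k w (\<alpha> i)) {1..N}"
    proof (rule inj_onI)
      fix i j assume ij: "i \<in> {1..N}" "j \<in> {1..N}" "int_inner k w (\<alpha> i) = int_inner k w (\<alpha> j)"
      then have "x (\<alpha> i) = x (\<alpha> j)" using w(2) \<alpha> by simp
      then have "\<alpha> i = \<alpha> j" using \<open>inj_on x (weights ?U Y)\<close> \<alpha> ij by (auto dest: inj_onD)
      then show "i = j" using enum ij by (auto simp: bij_betw_def dest: inj_onD)
    qed
  qed simp
  then show ?thesis by blast
qed

text \<open>The binary constraints make \<open>inner_hom k w\<close> injective on the weights,
  additivity makes it respect brackets, and the constraint \<open>\<ge> 1\<close> gives
  positivity.\<close>

lemma ilp_feasible_positive_realization:
  fixes Y :: "(nat \<Rightarrow> int) \<Rightarrow> 'g set"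
  assumes Y: "realization A V (int_pow_group k) Y"
    and enum: "bij_betw \<alpha> {1..N} (weights (int_pow_group k) Y)"
    and feas: "ilp_feasible k N \<alpha> z w b"
  defines "P \<equiv> pushforward (int_pow_group k) (inner_hom k w) Y"
  shows "positive_realization A V P"
    and "weights real_group P = (\<lambda>i. real_of_int (int_inner k w (\<alpha> i))) ` {1..N}"
proof -
  let ?U = "int_pow_group k"
  have grY: "grading ?U Y" using Y by (simp add: realization_def)
  have im: "weights ?U Y = \<alpha> ` {1..N}" using enum by (simp add: bij_betw_def)
  have inj: "inj_on (inner_hom k w) (weights ?U Y)"
    unfolding im inj_on_def inner_hom_def
    using ilp_feasible_inj_on[OF feas, unfolded inj_on_def] by fastforce
  have resp: "respects_brackets ?U Y real_group (inner_hom k w)"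
    by (simp add: respects_brackets_def inner_hom_def int_inner_add)
  have "realization ?U Y real_group P"
    unfolding P_def by (rule realization_pushforward[OF grY comm_group_real_group inj _ resp]) simp
  then have real: "realization A V real_group P" by (rule realization_trans[OF Y])
  show weights: "weights real_group P = (\<lambda>i. real_of_int (int_inner k w (\<alpha> i))) ` {1..N}"
    unfolding P_def using weights_pushforward[OF grY inj, of real_group]
    by (simp add: im image_image inner_hom_def)
  show "positive_realization A V P"
    using real feas by (force simp: positive_realization_def weights ilp_feasible_def)
qed

text \<open>The weights of \<open>W\<close> form an integer labelling that respects brackets, so the
  universal property supplies \<open>w\<close>. The bound on \<open>z\<close> is the one under which
  \<open>ex_ilp_feasible\<close> provides the binary variables.\<close>

lemma integer_realization_ilp_feasible:
  fixes Y :: "(nat \<Rightarrow> int) \<Rightarrow> 'g set"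
  assumes inf: "infinite (UNIV :: 'u set)"
    and univ: "universal_realization TYPE('u) A V (int_pow_group k) Y"
    and enum: "bij_betw \<alpha> {1..N} (weights (int_pow_group k) Y)"
    and W: "positive_realization A V W" "weights real_group W \<subseteq> \<int>"
    and z: "\<And>r. r \<in> weights real_group W \<Longrightarrow> r \<le> real_of_int z" "z \<le> ilp_C k N \<alpha> + 1"
  shows "\<exists>w b. ilp_feasible k N \<alpha> z w b"
proof -
  let ?U = "int_pow_group k"
  have Y: "realization A V ?U Y" using univ by (simp add: universal_realization_def)
  have W': "realization A V real_group W" "\<And>r. r \<in> weights real_group W \<Longrightarrow> 0 < r"
    using W by (simp_all add: positive_realization_def)
  obtain h where h: "bij_betw h (weights ?U Y) (weights real_group W)"
    "respects_brackets ?U Y real_group h"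
    using realizations_relabelling[OF Y W'(1)] by blast
  have grY: "grading ?U Y" using Y by (simp add: realization_def)
  \<comment> \<open>The real labels are integers already; the floor only changes their type.\<close>
  define x where "x a = \<lfloor>h a\<rfloor>" for a
  have x: "real_of_int (x a) = h a" if "a \<in> weights ?U Y" for a
    using W(2) bij_betwE[OF h(1)] that by (auto simp: x_def elim!: Ints_cases)
  have inj: "inj_on x (weights ?U Y)"
  proof (rule inj_onI)
    fix a b assume ab: "a \<in> weights ?U Y" "b \<in> weights ?U Y" "x a = x b"
    then have "h a = h b" using x by metis
    then show "a = b" using h(1) ab by (auto simp: bij_betw_def dest: inj_onD)
  qed
  have "respects_brackets ?U Y integer_group x"
    unfolding respects_brackets_def
  proof (intro ballI impI)
    fix a b assume a: "a \<in> weights ?U Y" and b: "b \<in> weights ?U Y"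
      and nz: "\<exists>p\<in>Y a. \<exists>q\<in>Y b. bracket p q \<noteq> 0"
    have ab: "a \<otimes>\<^bsub>?U\<^esub> b \<in> weights ?U Y" using bracket_nonzero_weight[OF grY a b] nz by blast
    have "h (a \<otimes>\<^bsub>?U\<^esub> b) = h a \<otimes>\<^bsub>real_group\<^esub> h b"
      using h(2) a b nz unfolding respects_brackets_def by blast
    then have "h (a \<otimes>\<^bsub>?U\<^esub> b) = h a + h b" by (simp only: real_group_simps)
    then have "real_of_int (x (a \<otimes>\<^bsub>?U\<^esub> b)) = real_of_int (x a + x b)"
      using x[OF a] x[OF b] x[OF ab] by simp
    then show "x (a \<otimes>\<^bsub>?U\<^esub> b) = x a \<otimes>\<^bsub>integer_group\<^esub> x b"
      by (simp only: of_int_eq_iff mult_integer_group)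
  qed
  then obtain w where w: "w \<in> carrier ?U"
    "\<And>a. a \<in> weights ?U Y \<Longrightarrow> int_inner k w a = x a"
    using universal_realization_integer_labelling[OF inf univ inj] by blast
  have \<alpha>: "\<alpha> i \<in> weights ?U Y" if "i \<in> {1..N}" for i using bij_betwE[OF enum] that by blast
  have "\<exists>b. ilp_feasible k N \<alpha> z w b"
  proof (rule ex_ilp_feasible[OF w(1) _ _ z(2)])
    fix i assume i: "i \<in> {1..N}"
    have "h (\<alpha> i) \<in> weights real_group W" using bij_betwE[OF h(1)] \<alpha>[OF i] by blast
    then have "0 < real_of_int (x (\<alpha> i))" "real_of_int (x (\<alpha> i)) \<le> real_of_int z"
      using W'(2) z(1) x[OF \<alpha>[OF i]] by auto
    then show "1 \<le> int_inner k w (\<alpha> i) \<and> int_inner k w (\<alpha> i) \<le> z"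
      using w(2)[OF \<alpha>[OF i]] by simp
  next
    show "inj_on (\<lambda>i. int_inner k w (\<alpha> i)) {1..N}"
    proof (rule inj_onI)
      fix i j assume ij: "i \<in> {1..N}" "j \<in> {1..N}" "int_inner k w (\<alpha> i) = int_inner k w (\<alpha> j)"
      then have "\<alpha> i = \<alpha> j" using w(2) \<alpha> inj by (auto dest: inj_onD)
      then show "i = j" using enum ij by (auto simp: bij_betw_def dest: inj_onD)
    qed
  qed
  then show ?thesis by blast
qed

end

theorem mainTheorem4:
  fixes scale :: "'k::field_char_0 \<Rightarrow> 'g::ab_group_add \<Rightarrow> 'g"
    and bracket :: "'g \<Rightarrow> 'g \<Rightarrow> 'g"
    and A :: "'a monoid" and V :: "'a \<Rightarrow> 'g set"
    and k N :: nat
    and Vt :: "(nat \<Rightarrow> int) \<Rightarrow> 'g set"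
    and \<alpha> :: "nat \<Rightarrow> nat \<Rightarrow> int"
  assumes lie: "lie_algebra scale bracket"
    and fin_dim: "\<exists>Basis. finite_dimensional_vector_space scale Basis"
    and grading: "lie_algebra.grading scale bracket A V"
    and torsion_free: "torsion_free_group A"
    and infinite_universe: "infinite (UNIV :: 'b set)"
    and universal:
      "lie_algebra.universal_realization scale bracket TYPE('b) A V (int_pow_group k) Vt"
    and N: "N \<ge> 1"
    and enum: "bij_betw \<alpha> {1..N} (lie_algebra.weights (int_pow_group k) Vt)"
  shows
    "((\<nexists>z w b. ilp_feasible k N \<alpha> z w b) \<longrightarrow>
        (\<nexists>W. lie_algebra.positive_realization scale bracket A V W)) \<and>
     (\<forall>z w b. ilp_optimal k N \<alpha> z w b \<longrightarrow>
        (let P = lie_algebra.pushforward scale (int_pow_group k) (inner_hom k w) Vt in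
           lie_algebra.positive_realization scale bracket A V P \<and>
           lie_algebra.weights real_group P \<subseteq> \<int> \<and>
           (\<forall>W. lie_algebra.positive_realization scale bracket A V W \<longrightarrow>
                lie_algebra.weights real_group W \<subseteq> \<int> \<longrightarrow>
                Max (lie_algebra.weights real_group P) \<le> Max (lie_algebra.weights real_group W))))"
proof -
  interpret lie_algebra scale bracket by (rule lie)
  note small = positive_realization_ex_small_ilp_feasible[OF infinite_universe universal N enum]
  have Vt: "realization A V (int_pow_group k) Vt"
    using universal by (simp add: universal_realization_def)
  have "\<forall>z w b. ilp_optimal k N \<alpha> z w b \<longrightarrow>
        (let P = pushforward (int_pow_group k) (inner_hom k w) Vt in
           positive_realization A V P \<and> weights real_group P \<subseteq> \<int> \<and>
           (\<forall>W. positive_realization A V W \<longrightarrow> weights real_group W \<subseteq> \<int> \<longrightarrow>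
                Max (weights real_group P) \<le> Max (weights real_group W)))"
    unfolding Let_def
  proof (intro allI impI conjI)
    fix z w b assume opt: "ilp_optimal k N \<alpha> z w b"
    then have feas: "ilp_feasible k N \<alpha> z w b"
      and min: "\<And>z' w' b'. ilp_feasible k N \<alpha> z' w' b' \<Longrightarrow> z \<le> z'"
      by (auto simp: ilp_optimal_def)
    let ?P = "pushforward (int_pow_group k) (inner_hom k w) Vt"
    note P = ilp_feasible_positive_realization[OF Vt enum feas]
    show "positive_realization A V ?P" by (rule P(1))
    show "weights real_group ?P \<subseteq> \<int>" unfolding P(2) by auto
    fix W assume W: "positive_realization A V W" "weights real_group W \<subseteq> \<int>"
    have "realization A V real_group W" using W(1) by (simp add: positive_realization_def)
    then obtain h where h: "bij_betw h (weights (int_pow_group k) Vt) (weights real_group W)"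
      using realizations_relabelling[OF Vt] by blast
    have "bij_betw (h \<circ> \<alpha>) {1..N} (weights real_group W)" by (rule bij_betw_trans[OF enum h])
    then have im: "weights real_group W = (h \<circ> \<alpha>) ` {1..N}" by (simp add: bij_betw_def)
    have fin: "finite (weights real_group W)" "weights real_group W \<noteq> {}"
      unfolding im using N by auto
    define z' where "z' = \<lfloor>Max (weights real_group W)\<rfloor>"
    have z': "real_of_int z' = Max (weights real_group W)"
      using W(2) Max_in[OF fin] by (auto simp: z'_def elim!: Ints_cases)
    \<comment> \<open>If \<open>z'\<close> is at most \<open>ilp_C k N \<alpha> + 1\<close>, then
      \<open>W\<close> itself gives a feasible point with value \<open>z'\<close>. Otherwise the
      point from \<open>small\<close> shows
      \<open>z \<le> ilp_C k N \<alpha> + 1 < z'\<close>.\<close>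
    have "z \<le> z'"
    proof (cases "z' \<le> ilp_C k N \<alpha> + 1")
      case True
      then have "\<exists>w b. ilp_feasible k N \<alpha> z' w b"
        using integer_realization_ilp_feasible[OF infinite_universe universal enum W] fin z' by simp
      then show ?thesis using min by blast
    next
      case False
      then show ?thesis using small[OF W(1)] min by fastforce
    qed
    moreover have "Max (weights real_group ?P) \<le> real_of_int z"
      unfolding P(2) using N feas by (subst Max_le_iff) (auto simp: ilp_feasible_def)
    ultimately show "Max (weights real_group ?P) \<le> Max (weights real_group W)"
      using z' by linarith
  qed
  \<comment> \<open>The claim on infeasibility is the contrapositive of
    \<open>small\<close>.\<close>
  then show ?thesis using small by blast
qed

end
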